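(* Let $G$ be a finite group, let $X=Y=G$ with $G$ acting by left multiplication, let $n\ge1$, and let $\mathcal O\subseteq G\times G$ be an irreducible $G$-stable subset. Then: (1) $\mathbf h^0(G,\mathcal O)=\mathbf h^1(G,\mathcal O)$. (2) The group $\mathbf h^2(G,\mathcal O)$ is the closure under $D$-equivalence of the set of all cocyclic $G$-matrices with values in $\mu_n^+$ and with support $\mathcal O$. (3) There is an isomorphism of groups $\mathbf h^2(G,\mathcal O)/\mathbf h^0(G,\mathcal O)\cong H^2(G,\mu_n)$.
   Context: $\mu_n\subset\mathbb C^\times$ is the group of $n$-th roots of unity with trivial $G$-action, $\mu_n^+=\{0\}\cup\mu_n$. $X\times Y$ matrices over $\mu_n^+$ are functions $A:X\times Y\to\mu_n^+$; the support is the set of positions of nonzero entries; $(gA)_{x,y}=A_{g^{-1}x,g^{-1}y}$. $\mathcal O\subseteq X\times Y$ is irreducible if the bipartite graph on $X\sqcup Y$ (disjoint copies) with an edge $\{x,y\}$ for each $(x,y)\in\mathcal O$ is connected. $D_X,D_Y$ are the groups of diagonal matrices with diagonal entries in $\mu_n$ indexed by $X,Y$; $A,B$ are $D$-equivalent if $A=LBR^*$ with $L\in D_X$, $R\in D_Y$ ($*$ is conjugate-transpose). The following are abelian groups under the Hadamard (entrywise) product, with neutral element the characteristic matrix of $\mathcal O$: $\mathbf h^2(G,\mathcal O)=\mathbf h(G,\mathcal O)$, the set of matrices $A$ over $\mu_n^+$ with support exactly $\mathcal O$ such that for every $g\in G$ there are $L(g)\in D_X$, $R(g)\in D_Y$ with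 $A=L(g)(gA)R(g)^*$; $\mathbf h^0(G,\mathcal O)$, the subset of those $D$-equivalent to a matrix $B$ with $gB=B$ for all $g\in G$; $\mathbf h^1(G,\mathcal O)$, the subset of those $A$ for which there is a homomorphism $g\mapsto(P(g),Q(g))$ from $G$ to pairs of monomial matrices (indexed by $X$ and $Y$, nonzero entries in $\mu_n$) with $|P(g)|,|Q(g)|$ the permutation matrices of $g$ on $X,Y$ and $P(g)AQ(g)^*=A$ for all $g\in G$. A 2-cocycle $\omega\in Z^2(G,\mu_n)$ is a function $\omega:G\times G\to\mu_n$ with $\omega(g_2,g_3)\,\omega(g_1g_2,g_3)^{-1}\,\omega(g_1,g_2g_3)\,\omega(g_1,g_2)^{-1}=1$. The pure cocyclic matrix $C(\omega)$ has $C_{x,y}=\omega(x^{-1},y)$ for $(x,y)\in\mathcal O$ and $0$ otherwise. A cocyclic $G$-matrix is an entrywise product $K\circ C(\omega)$ with $K$ a $G$-developed matrix, i.e. $K_{x,y}=f(x^{-1}y)$ for some function $f$ on $G$. *)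

theory Defs
  imports Complex_Main "HOL-Algebra.Group_Action"
begin

section \<open>Matrices over the roots of unity and zero\<close>

definition mu :: "nat \<Rightarrow> complex set" where
  "mu n = {z. z ^ n = 1}"

definition mu_plus :: "nat \<Rightarrow> complex set" where
  "mu_plus n = insert 0 (mu n)"

text \<open>A matrix indexed by \<open>X \<times> Y\<close> is a function on the ambient types that vanishes outside
  \<open>X \<times> Y\<close>, so that equality of matrices is equality of functions.\<close>

type_synonym ('x, 'y) cmat = "'x \<Rightarrow> 'y \<Rightarrow> complex"

definition mats :: "nat \<Rightarrow> 'x set \<Rightarrow> 'y set \<Rightarrow> ('x, 'y) cmat set" where
  "mats n X Y = {A. (\<forall>x\<in>X. \<forall>y\<in>Y. A x y \<in> mu_plus n) \<and>
                    (\<forall>x y. (x, y) \<notin> X \<times> Y \<longrightarrow> A x y = 0)}"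

definition supp :: "('x, 'y) cmat \<Rightarrow> ('x \<times> 'y) set" where
  "supp A = {(x, y). A x y \<noteq> 0}"

text \<open>The product of matrices, where \<open>Y\<close> is the finite set indexing the columns of \<open>A\<close> and
  the rows of \<open>B\<close>.\<close>

definition mmul :: "'y set \<Rightarrow> ('x, 'y) cmat \<Rightarrow> ('y, 'z) cmat \<Rightarrow> ('x, 'z) cmat" where
  "mmul Y A B = (\<lambda>x z. \<Sum>y\<in>Y. A x y * B y z)"

definition adj :: "('x, 'y) cmat \<Rightarrow> ('y, 'x) cmat" where
  "adj A = (\<lambda>y x. cnj (A x y))"

definition hadamard :: "('x, 'y) cmat \<Rightarrow> ('x, 'y) cmat \<Rightarrow> ('x, 'y) cmat" where
  "hadamard A B = (\<lambda>x y. A x y * B x y)"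

definition char_mat :: "('x \<times> 'y) set \<Rightarrow> ('x, 'y) cmat" where
  "char_mat \<O> = (\<lambda>x y. if (x, y) \<in> \<O> then 1 else 0)"

definition diag_mats :: "nat \<Rightarrow> 'x set \<Rightarrow> ('x, 'x) cmat set" where
  "diag_mats n X = {L \<in> mats n X X. (\<forall>x\<in>X. L x x \<in> mu n) \<and> (\<forall>x x'. x \<noteq> x' \<longrightarrow> L x x' = 0)}"

definition D_equiv :: "nat \<Rightarrow> 'x set \<Rightarrow> 'y set \<Rightarrow> ('x, 'y) cmat \<Rightarrow> ('x, 'y) cmat \<Rightarrow> bool" where
  "D_equiv n X Y A B \<longleftrightarrow>
     (\<exists>L\<in>diag_mats n X. \<exists>R\<in>diag_mats n Y. A = mmul X L (mmul Y B (adj R)))"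

definition D_closure :: "nat \<Rightarrow> 'x set \<Rightarrow> 'y set \<Rightarrow> ('x, 'y) cmat set \<Rightarrow> ('x, 'y) cmat set" where
  "D_closure n X Y M = {A. \<exists>B\<in>M. D_equiv n X Y A B}"

definition monomial_group :: "nat \<Rightarrow> 'x set \<Rightarrow> ('x, 'x) cmat monoid" where
  "monomial_group n X =
     \<lparr>carrier = {P \<in> mats n X X. (\<forall>x\<in>X. \<exists>!x'. x' \<in> X \<and> P x x' \<noteq> 0) \<and>
                                 (\<forall>x'\<in>X. \<exists>!x. x \<in> X \<and> P x x' \<noteq> 0)},
      mult = mmul X,
      one = (\<lambda>x x'. if x \<in> X \<and> x = x' then 1 else 0)\<rparr>"

definition abs_mat :: "('x, 'y) cmat \<Rightarrow> ('x, 'y) cmat" where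
  "abs_mat A = (\<lambda>x y. complex_of_real (cmod (A x y)))"

text \<open>The permutation matrix of \<open>a : X \<rightarrow> X\<close> sends the basis vector at \<open>x'\<close> to the one at
  \<open>a x'\<close>; with this convention \<open>g\<close> acts on matrices by \<open>A \<mapsto> P\<^sub>X(g) A P\<^sub>Y(g)\<^sup>*\<close>.\<close>

definition perm_mat :: "'x set \<Rightarrow> ('x \<Rightarrow> 'x) \<Rightarrow> ('x, 'x) cmat" where
  "perm_mat X a = (\<lambda>x x'. if x' \<in> X \<and> x = a x' then 1 else 0)"


section \<open>Matrices with prescribed support, up to a group action\<close>

text \<open>Throughout, \<open>G\<close> acts on \<open>X\<close> by \<open>\<phi>\<close> and on \<open>Y\<close> by \<open>\<psi>\<close>, in the sense of
  \<^locale>\<open>group_action\<close>.\<close>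

definition stable_set ::
  "('g, 'm) monoid_scheme \<Rightarrow> ('g \<Rightarrow> 'x \<Rightarrow> 'x) \<Rightarrow> ('g \<Rightarrow> 'y \<Rightarrow> 'y) \<Rightarrow> ('x \<times> 'y) set \<Rightarrow> bool" where
  "stable_set G \<phi> \<psi> \<O> \<longleftrightarrow> (\<forall>g\<in>carrier G. \<forall>(x, y)\<in>\<O>. (\<phi> g x, \<psi> g y) \<in> \<O>)"

text \<open>The disjoint union of \<open>X\<close> and \<open>Y\<close> is the vertex set; edges are taken in both directions.\<close>

definition bip_edges :: "('x \<times> 'y) set \<Rightarrow> ('x + 'y) rel" where
  "bip_edges \<O> = {(Inl x, Inr y) | x y. (x, y) \<in> \<O>} \<union> {(Inr y, Inl x) | x y. (x, y) \<in> \<O>}"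

definition irreducible_set :: "'x set \<Rightarrow> 'y set \<Rightarrow> ('x \<times> 'y) set \<Rightarrow> bool" where
  "irreducible_set X Y \<O> \<longleftrightarrow> (\<forall>u \<in> X <+> Y. \<forall>v \<in> X <+> Y. (u, v) \<in> (bip_edges \<O>)\<^sup>*)"

definition act_mat ::
  "('g, 'm) monoid_scheme \<Rightarrow> 'x set \<Rightarrow> ('g \<Rightarrow> 'x \<Rightarrow> 'x) \<Rightarrow> 'y set \<Rightarrow> ('g \<Rightarrow> 'y \<Rightarrow> 'y) \<Rightarrow>
   'g \<Rightarrow> ('x, 'y) cmat \<Rightarrow> ('x, 'y) cmat" where
  "act_mat G X \<phi> Y \<psi> g A =
     (\<lambda>x y. if (x, y) \<in> X \<times> Y then A (\<phi> (inv\<^bsub>G\<^esub> g) x) (\<psi> (inv\<^bsub>G\<^esub> g) y) else 0)"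

definition h2 ::
  "nat \<Rightarrow> ('g, 'm) monoid_scheme \<Rightarrow> 'x set \<Rightarrow> ('g \<Rightarrow> 'x \<Rightarrow> 'x) \<Rightarrow> 'y set \<Rightarrow> ('g \<Rightarrow> 'y \<Rightarrow> 'y) \<Rightarrow>
   ('x \<times> 'y) set \<Rightarrow> ('x, 'y) cmat set" where
  "h2 n G X \<phi> Y \<psi> \<O> =
     {A \<in> mats n X Y. supp A = \<O> \<and> (\<forall>g\<in>carrier G. D_equiv n X Y A (act_mat G X \<phi> Y \<psi> g A))}"

definition h0 ::
  "nat \<Rightarrow> ('g, 'm) monoid_scheme \<Rightarrow> 'x set \<Rightarrow> ('g \<Rightarrow> 'x \<Rightarrow> 'x) \<Rightarrow> 'y set \<Rightarrow> ('g \<Rightarrow> 'y \<Rightarrow> 'y) \<Rightarrow>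
   ('x \<times> 'y) set \<Rightarrow> ('x, 'y) cmat set" where
  "h0 n G X \<phi> Y \<psi> \<O> =
     {A \<in> h2 n G X \<phi> Y \<psi> \<O>.
        \<exists>B\<in>mats n X Y. (\<forall>g\<in>carrier G. act_mat G X \<phi> Y \<psi> g B = B) \<and> D_equiv n X Y A B}"

definition h1 ::
  "nat \<Rightarrow> ('g, 'm) monoid_scheme \<Rightarrow> 'x set \<Rightarrow> ('g \<Rightarrow> 'x \<Rightarrow> 'x) \<Rightarrow> 'y set \<Rightarrow> ('g \<Rightarrow> 'y \<Rightarrow> 'y) \<Rightarrow>
   ('x \<times> 'y) set \<Rightarrow> ('x, 'y) cmat set" where
  "h1 n G X \<phi> Y \<psi> \<O> =
     {A \<in> h2 n G X \<phi> Y \<psi> \<O>.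
        \<exists>P Q. (\<lambda>g. (P g, Q g)) \<in> hom G (monomial_group n X \<times>\<times> monomial_group n Y) \<and>
              (\<forall>g\<in>carrier G. abs_mat (P g) = perm_mat X (\<phi> g) \<and>
                             abs_mat (Q g) = perm_mat Y (\<psi> g) \<and>
                             mmul X (P g) (mmul Y A (adj (Q g))) = A)}"

definition h2_group ::
  "nat \<Rightarrow> ('g, 'm) monoid_scheme \<Rightarrow> 'x set \<Rightarrow> ('g \<Rightarrow> 'x \<Rightarrow> 'x) \<Rightarrow> 'y set \<Rightarrow> ('g \<Rightarrow> 'y \<Rightarrow> 'y) \<Rightarrow>
   ('x \<times> 'y) set \<Rightarrow> ('x, 'y) cmat monoid" where
  "h2_group n G X \<phi> Y \<psi> \<O> =
     \<lparr>carrier = h2 n G X \<phi> Y \<psi> \<O>, mult = hadamard, one = char_mat \<O>\<rparr>"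


section \<open>Second cohomology with coefficients in the roots of unity\<close>

text \<open>The action on the coefficients is trivial.\<close>

definition Z2 :: "nat \<Rightarrow> ('g, 'm) monoid_scheme \<Rightarrow> ('g \<times> 'g \<Rightarrow> complex) set" where
  "Z2 n G =
     {\<omega> \<in> (carrier G \<times> carrier G) \<rightarrow>\<^sub>E mu n.
        \<forall>g1\<in>carrier G. \<forall>g2\<in>carrier G. \<forall>g3\<in>carrier G.
          \<omega> (g2, g3) * inverse (\<omega> (g1 \<otimes>\<^bsub>G\<^esub> g2, g3)) *
          \<omega> (g1, g2 \<otimes>\<^bsub>G\<^esub> g3) * inverse (\<omega> (g1, g2)) = 1}"

definition Z2_group :: "nat \<Rightarrow> ('g, 'm) monoid_scheme \<Rightarrow> ('g \<times> 'g \<Rightarrow> complex) monoid" where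
  "Z2_group n G =
     \<lparr>carrier = Z2 n G,
      mult = (\<lambda>\<omega> \<omega>'. \<lambda>p\<in>carrier G \<times> carrier G. \<omega> p * \<omega>' p),
      one = (\<lambda>p\<in>carrier G \<times> carrier G. 1)\<rparr>"

definition coboundary ::
  "('g, 'm) monoid_scheme \<Rightarrow> ('g \<Rightarrow> complex) \<Rightarrow> 'g \<times> 'g \<Rightarrow> complex" where
  "coboundary G c =
     (\<lambda>(g, h)\<in>carrier G \<times> carrier G. c h * inverse (c (g \<otimes>\<^bsub>G\<^esub> h)) * c g)"

definition B2 :: "nat \<Rightarrow> ('g, 'm) monoid_scheme \<Rightarrow> ('g \<times> 'g \<Rightarrow> complex) set" where
  "B2 n G = coboundary G ` (carrier G \<rightarrow> mu n)"

definition H2 :: "nat \<Rightarrow> ('g, 'm) monoid_scheme \<Rightarrow> ('g \<times> 'g \<Rightarrow> complex) set monoid" where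
  "H2 n G = Z2_group n G Mod B2 n G"


section \<open>Cocyclic matrices\<close>

definition left_mult :: "('g, 'm) monoid_scheme \<Rightarrow> 'g \<Rightarrow> 'g \<Rightarrow> 'g" where
  "left_mult G g = (\<lambda>x\<in>carrier G. g \<otimes>\<^bsub>G\<^esub> x)"

definition pure_cocyclic ::
  "('g, 'm) monoid_scheme \<Rightarrow> ('g \<times> 'g) set \<Rightarrow> ('g \<times> 'g \<Rightarrow> complex) \<Rightarrow> ('g, 'g) cmat" where
  "pure_cocyclic G \<O> \<omega> = (\<lambda>x y. if (x, y) \<in> \<O> then \<omega> (inv\<^bsub>G\<^esub> x, y) else 0)"

definition developed :: "('g, 'm) monoid_scheme \<Rightarrow> ('g, 'g) cmat \<Rightarrow> bool" where
  "developed G K \<longleftrightarrow>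
     (\<forall>x y. (x, y) \<notin> carrier G \<times> carrier G \<longrightarrow> K x y = 0) \<and>
     (\<exists>f. \<forall>x\<in>carrier G. \<forall>y\<in>carrier G. K x y = f (inv\<^bsub>G\<^esub> x \<otimes>\<^bsub>G\<^esub> y))"

definition cocyclic_mats ::
  "nat \<Rightarrow> ('g, 'm) monoid_scheme \<Rightarrow> ('g \<times> 'g) set \<Rightarrow> ('g, 'g) cmat set" where
  "cocyclic_mats n G \<O> =
     {hadamard K (pure_cocyclic G \<O> \<omega>) | K \<omega>. developed G K \<and> \<omega> \<in> Z2 n G}"


section \<open>The quotients are quotients of abelian groups by subgroups\<close>

lemma mu_closed:
  assumes "a \<in> mu n" "b \<in> mu n"
  shows "a * b \<in> mu n" "inverse a \<in> mu n" "cnj a \<in> mu n"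
  using assms by (auto simp: mu_def power_mult_distrib power_inverse simp flip: complex_cnj_power)

lemma one_in_mu: "1 \<in> mu n"
  by (simp add: mu_def)

lemma mu_nonzero: "1 \<le> n \<Longrightarrow> a \<in> mu n \<Longrightarrow> a \<noteq> 0"
  by (auto simp: mu_def power_0_left)

lemma mu_plus_closed:
  assumes "a \<in> mu_plus n" "b \<in> mu_plus n"
  shows "a * b \<in> mu_plus n"
  using assms by (auto simp: mu_plus_def mu_closed)

lemma mu_plus_inverse: "a \<in> mu_plus n \<Longrightarrow> inverse a \<in> mu_plus n"
  by (auto simp: mu_plus_def mu_closed)

lemma group_action_left_mult:
  assumes "group G"
  shows "group_action G (carrier G) (left_mult G)"
proof -
  interpret group G by fact
  have bij: "left_mult G g \<in> Bij (carrier G)" if g: "g \<in> carrier G" for g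
  proof -
    have "bij_betw (\<lambda>x. g \<otimes>\<^bsub>G\<^esub> x) (carrier G) (carrier G)"
      by (rule bij_betw_byWitness[where f' = "\<lambda>x. inv\<^bsub>G\<^esub> g \<otimes>\<^bsub>G\<^esub> x"])
        (use g in \<open>auto simp: m_assoc[symmetric]\<close>)
    then show ?thesis
      by (auto simp: Bij_def left_mult_def cong: bij_betw_cong)
  qed
  have "left_mult G \<in> hom G (BijGroup (carrier G))"
    by (rule homI)
      (auto simp: BijGroup_def bij left_mult_def[abs_def] compose_def m_assoc
        intro!: restrict_ext bij[unfolded left_mult_def])
  then show ?thesis
    by (auto simp: group_action_def group_hom_def group_hom_axioms_def group_BijGroup is_group)
qed

lemma mmul_diag:
  assumes "finite X" "finite Y" "L \<in> diag_mats n X" "R \<in> diag_mats n Y"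
  shows "mmul X L (mmul Y B (adj R)) =
           (\<lambda>x y. if (x, y) \<in> X \<times> Y then L x x * B x y * cnj (R y y) else 0)"
proof (intro ext)
  fix x y
  have L: "L x x' = (if x = x' \<and> x \<in> X then L x x else 0)" for x'
    using assms(3) by (auto simp: diag_mats_def mats_def)
  have R: "R y y' = (if y = y' \<and> y \<in> Y then R y y else 0)" for y'
    using assms(4) by (auto simp: diag_mats_def mats_def)
  have 1: "(\<Sum>y'\<in>Y. B x' y' * cnj (R y y')) = (if y \<in> Y then B x' y * cnj (R y y) else 0)" for x'
  proof -
    have "(\<Sum>y'\<in>Y. B x' y' * cnj (R y y')) =
          (\<Sum>y'\<in>Y. if y = y' then B x' y * cnj (R y y) else 0)"
      by (rule sum.cong) (use R in \<open>auto\<close>)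
    then show ?thesis using assms(2) by simp
  qed
  have "(\<Sum>x'\<in>X. L x x' * c x') = (if x \<in> X then L x x * c x else 0)" for c
  proof -
    have "(\<Sum>x'\<in>X. L x x' * c x') = (\<Sum>x'\<in>X. if x = x' then L x x * c x else 0)"
      by (rule sum.cong) (use L in \<open>auto\<close>)
    then show ?thesis using assms(1) by simp
  qed
  then show "mmul X L (mmul Y B (adj R)) x y =
      (if (x, y) \<in> X \<times> Y then L x x * B x y * cnj (R y y) else 0)"
    by (simp add: mmul_def adj_def 1)
qed

lemma D_equiv_iff:
  assumes "finite X" "finite Y" "1 \<le> n"
  shows "D_equiv n X Y A B \<longleftrightarrow>
    (\<exists>l\<in>X \<rightarrow> mu n. \<exists>r\<in>Y \<rightarrow> mu n.
       A = (\<lambda>x y. if (x, y) \<in> X \<times> Y then l x * B x y * r y else 0))" (is "_ \<longleftrightarrow> ?R")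
proof
  assume "D_equiv n X Y A B"
  then obtain L R where LR: "L \<in> diag_mats n X" "R \<in> diag_mats n Y"
    and A: "A = mmul X L (mmul Y B (adj R))"
    by (auto simp: D_equiv_def)
  show ?R
    by (rule bexI[of _ "\<lambda>x. L x x"], rule bexI[of _ "\<lambda>y. cnj (R y y)"])
      (use LR in \<open>auto simp: A mmul_diag[OF assms(1,2) LR] diag_mats_def mu_closed\<close>)
next
  assume ?R
  then obtain l r where lr: "l \<in> X \<rightarrow> mu n" "r \<in> Y \<rightarrow> mu n"
    and A: "A = (\<lambda>x y. if (x, y) \<in> X \<times> Y then l x * B x y * r y else 0)"
    by auto
  define L where "L = (\<lambda>x x'. if x \<in> X \<and> x = x' then l x else 0)"
  define R where "R = (\<lambda>y y'. if y \<in> Y \<and> y = y' then cnj (r y) else 0)"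
  have LR: "L \<in> diag_mats n X" "R \<in> diag_mats n Y"
    using lr by (auto simp: L_def R_def diag_mats_def mats_def mu_plus_def mu_closed Pi_iff)
  have "A = mmul X L (mmul Y B (adj R))"
    unfolding mmul_diag[OF assms(1,2) LR] A by (auto simp: L_def R_def fun_eq_iff)
  with LR show "D_equiv n X Y A B"
    by (auto simp: D_equiv_def)
qed

lemma D_equiv_hadamard:
  assumes "finite X" "finite Y" "1 \<le> n" "D_equiv n X Y A B" "D_equiv n X Y A' B'"
  shows "D_equiv n X Y (hadamard A A') (hadamard B B')"
proof -
  obtain l r l' r' where "l \<in> X \<rightarrow> mu n" "r \<in> Y \<rightarrow> mu n" "l' \<in> X \<rightarrow> mu n" "r' \<in> Y \<rightarrow> mu n"
    "A = (\<lambda>x y. if (x, y) \<in> X \<times> Y then l x * B x y * r y else 0)"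
    "A' = (\<lambda>x y. if (x, y) \<in> X \<times> Y then l' x * B' x y * r' y else 0)"
    using assms(4,5) unfolding D_equiv_iff[OF assms(1-3)] by blast
  then show ?thesis unfolding D_equiv_iff[OF assms(1-3)]
    by (intro bexI[of _ "\<lambda>x. l x * l' x"] bexI[of _ "\<lambda>y. r y * r' y"])
      (auto simp: hadamard_def fun_eq_iff Pi_iff mu_closed)
qed

definition hinv :: "('x, 'y) cmat \<Rightarrow> ('x, 'y) cmat" where
  "hinv A = (\<lambda>x y. inverse (A x y))"

lemma D_equiv_hinv:
  assumes "finite X" "finite Y" "1 \<le> n" "D_equiv n X Y A B"
  shows "D_equiv n X Y (hinv A) (hinv B)"
proof -
  obtain l r where "l \<in> X \<rightarrow> mu n" "r \<in> Y \<rightarrow> mu n"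
    "A = (\<lambda>x y. if (x, y) \<in> X \<times> Y then l x * B x y * r y else 0)"
    using assms(4) unfolding D_equiv_iff[OF assms(1-3)] by blast
  then show ?thesis unfolding D_equiv_iff[OF assms(1-3)]
    by (intro bexI[of _ "\<lambda>x. inverse (l x)"] bexI[of _ "\<lambda>y. inverse (r y)"])
      (auto simp: hinv_def fun_eq_iff Pi_iff mu_closed)
qed

lemma D_equiv_refl:
  assumes "finite X" "finite Y" "1 \<le> n" "A \<in> mats n X Y"
  shows "D_equiv n X Y A A"
  unfolding D_equiv_iff[OF assms(1-3)]
  by (rule bexI[of _ "\<lambda>x. 1"], rule bexI[of _ "\<lambda>y. 1"])
    (use assms(4) in \<open>auto simp: fun_eq_iff mats_def one_in_mu\<close>)

lemma act_hadamard:
  "act_mat G X \<phi> Y \<psi> g (hadamard A B) =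
     hadamard (act_mat G X \<phi> Y \<psi> g A) (act_mat G X \<phi> Y \<psi> g B)"
  by (auto simp: act_mat_def hadamard_def fun_eq_iff)

lemma act_hinv: "act_mat G X \<phi> Y \<psi> g (hinv A) = hinv (act_mat G X \<phi> Y \<psi> g A)"
  by (auto simp: act_mat_def hinv_def fun_eq_iff)

lemma mats_hadamard: "A \<in> mats n X Y \<Longrightarrow> B \<in> mats n X Y \<Longrightarrow> hadamard A B \<in> mats n X Y"
  by (auto simp: mats_def hadamard_def mu_plus_closed)

lemma mats_hinv: "A \<in> mats n X Y \<Longrightarrow> hinv A \<in> mats n X Y"
  by (auto simp: mats_def hinv_def mu_plus_inverse)

lemma supp_hadamard: "supp (hadamard A B) = supp A \<inter> supp B"
  by (auto simp: supp_def hadamard_def)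

lemma supp_hinv: "supp (hinv A) = supp A"
  by (auto simp: supp_def hinv_def)

lemma supp_char_mat: "supp (char_mat \<O>) = \<O>"
  by (auto simp: supp_def char_mat_def)

lemma mats_char_mat: "\<O> \<subseteq> X \<times> Y \<Longrightarrow> char_mat \<O> \<in> mats n X Y"
  by (auto simp: mats_def char_mat_def mu_plus_def one_in_mu)

lemma act_char_mat:
  assumes "group_action G X \<phi>" "group_action G Y \<psi>"
    and "\<O> \<subseteq> X \<times> Y" "stable_set G \<phi> \<psi> \<O>" "g \<in> carrier G"
  shows "act_mat G X \<phi> Y \<psi> g (char_mat \<O>) = char_mat \<O>"
proof -
  interpret x: group_action G X \<phi> by fact
  interpret y: group_action G Y \<psi> by fact
  interpret group G using x.group_hom by (simp add: group_hom_def)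
  have i: "inv\<^bsub>G\<^esub> g \<in> carrier G" using assms(5) by simp
  have "(\<phi> (inv\<^bsub>G\<^esub> g) x, \<psi> (inv\<^bsub>G\<^esub> g) y) \<in> \<O> \<longleftrightarrow> (x, y) \<in> \<O>" if "x \<in> X" "y \<in> Y" for x y
  proof
    assume "(\<phi> (inv\<^bsub>G\<^esub> g) x, \<psi> (inv\<^bsub>G\<^esub> g) y) \<in> \<O>"
    with assms(4,5) have "(\<phi> g (\<phi> (inv\<^bsub>G\<^esub> g) x), \<psi> g (\<psi> (inv\<^bsub>G\<^esub> g) y)) \<in> \<O>"
      by (auto simp: stable_set_def)
    moreover have "\<phi> g (\<phi> (inv\<^bsub>G\<^esub> g) x) = x" "\<psi> g (\<psi> (inv\<^bsub>G\<^esub> g) y) = y"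
      using x.orbit_sym_aux[OF i that(1)] y.orbit_sym_aux[OF i that(2)] assms(5) by auto
    ultimately show "(x, y) \<in> \<O>" by simp
  qed (use assms(4) i in \<open>auto simp: stable_set_def\<close>)
  with assms(3) show ?thesis
    by (auto simp: act_mat_def char_mat_def fun_eq_iff)
qed

lemma h2_hadamard:
  assumes "finite X" "finite Y" "1 \<le> n" "A \<in> h2 n G X \<phi> Y \<psi> \<O>" "B \<in> h2 n G X \<phi> Y \<psi> \<O>"
  shows "hadamard A B \<in> h2 n G X \<phi> Y \<psi> \<O>"
  using assms
  by (auto simp: h2_def mats_hadamard supp_hadamard act_hadamard intro!: D_equiv_hadamard)

lemma h2_hinv:
  assumes "finite X" "finite Y" "1 \<le> n" "A \<in> h2 n G X \<phi> Y \<psi> \<O>"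
  shows "hinv A \<in> h2 n G X \<phi> Y \<psi> \<O>"
  using assms by (auto simp: h2_def mats_hinv supp_hinv act_hinv intro!: D_equiv_hinv)

lemma hinv_hadamard: "supp A = \<O> \<Longrightarrow> hadamard (hinv A) A = char_mat \<O>"
  by (auto simp: hadamard_def hinv_def char_mat_def supp_def fun_eq_iff)

lemma char_mat_hadamard: "supp A = \<O> \<Longrightarrow> hadamard (char_mat \<O>) A = A"
  by (auto simp: hadamard_def char_mat_def supp_def fun_eq_iff)

proposition comm_group_h2:
  assumes "group_action G X \<phi>" "group_action G Y \<psi>" "finite X" "finite Y" "1 \<le> n"
    and "\<O> \<subseteq> X \<times> Y" "stable_set G \<phi> \<psi> \<O>"
  shows "comm_group (h2_group n G X \<phi> Y \<psi> \<O>)" (is "comm_group ?H")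
proof (rule comm_groupI)
  show "\<one>\<^bsub>?H\<^esub> \<in> carrier ?H"
    using assms by (auto simp: h2_group_def h2_def mats_char_mat supp_char_mat act_char_mat
        intro: D_equiv_refl)
next
  fix A B assume "A \<in> carrier ?H" "B \<in> carrier ?H"
  then show "A \<otimes>\<^bsub>?H\<^esub> B \<in> carrier ?H"
    using assms(3-5) by (simp add: h2_group_def h2_hadamard)
next
  fix A assume A: "A \<in> carrier ?H"
  then have "supp A = \<O>" by (simp add: h2_group_def h2_def)
  then show "\<one>\<^bsub>?H\<^esub> \<otimes>\<^bsub>?H\<^esub> A = A"
    by (simp add: h2_group_def char_mat_hadamard)
  show "\<exists>B\<in>carrier ?H. B \<otimes>\<^bsub>?H\<^esub> A = \<one>\<^bsub>?H\<^esub>"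
    using A assms(3-5) \<open>supp A = \<O>\<close>
    by (intro bexI[of _ "hinv A"]) (auto simp: h2_group_def h2_hinv hinv_hadamard)
qed (auto simp: h2_group_def hadamard_def mult_ac)

proposition subgroup_h0:
  assumes "group_action G X \<phi>" "group_action G Y \<psi>" "finite X" "finite Y" "1 \<le> n"
    and "\<O> \<subseteq> X \<times> Y" "stable_set G \<phi> \<psi> \<O>"
  shows "subgroup (h0 n G X \<phi> Y \<psi> \<O>) (h2_group n G X \<phi> Y \<psi> \<O>)" (is "subgroup ?S ?H")
proof -
  interpret comm_group ?H by (rule comm_group_h2[OF assms])
  have inv: "inv\<^bsub>?H\<^esub> A = hinv A" if "A \<in> carrier ?H" for A
  proof (rule inv_equality)
    show "hinv A \<otimes>\<^bsub>?H\<^esub> A = \<one>\<^bsub>?H\<^esub>" "hinv A \<in> carrier ?H"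
      using that assms(3-5) h2_hinv[of X Y n A G \<phi> \<psi> \<O>]
      by (auto simp: h2_group_def h2_def hinv_hadamard)
  qed (fact that)
  have sub: "?S \<subseteq> carrier ?H" by (auto simp: h0_def h2_group_def)
  show ?thesis
  proof (rule subgroupI)
    show "?S \<subseteq> carrier ?H" by (fact sub)
    have "char_mat \<O> \<in> carrier ?H"
      using one_closed by (simp add: h2_group_def)
    then have "char_mat \<O> \<in> ?S"
      using assms by (auto simp: h0_def h2_group_def mats_char_mat act_char_mat
          intro!: bexI[of _ "char_mat \<O>"] D_equiv_refl)
    then show "?S \<noteq> {}" by auto
  next
    fix A assume A: "A \<in> ?S"
    then obtain B where "B \<in> mats n X Y" "D_equiv n X Y A B"
      "\<forall>g\<in>carrier G. act_mat G X \<phi> Y \<psi> g B = B" "A \<in> h2 n G X \<phi> Y \<psi> \<O>"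
      by (auto simp: h0_def)
    then have "hinv A \<in> ?S"
      using assms(3-5) by (auto simp: h0_def h2_hinv mats_hinv act_hinv
          intro!: bexI[of _ "hinv B"] D_equiv_hinv)
    then show "inv\<^bsub>?H\<^esub> A \<in> ?S"
      using A sub by (auto simp: inv)
  next
    fix A A' assume "A \<in> ?S" "A' \<in> ?S"
    then obtain B B' where "B \<in> mats n X Y" "D_equiv n X Y A B"
      "\<forall>g\<in>carrier G. act_mat G X \<phi> Y \<psi> g B = B" "A \<in> h2 n G X \<phi> Y \<psi> \<O>"
      "B' \<in> mats n X Y" "D_equiv n X Y A' B'"
      "\<forall>g\<in>carrier G. act_mat G X \<phi> Y \<psi> g B' = B'" "A' \<in> h2 n G X \<phi> Y \<psi> \<O>"
      by (auto simp: h0_def)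
    then have "hadamard A A' \<in> ?S"
      using assms(3-5) by (auto simp: h0_def h2_hadamard mats_hadamard act_hadamard
          intro!: bexI[of _ "hadamard B B'"] D_equiv_hadamard)
    then show "A \<otimes>\<^bsub>?H\<^esub> A' \<in> ?S" by (simp add: h2_group_def)
  qed
qed

lemma Z2_iff:
  "\<omega> \<in> Z2 n G \<longleftrightarrow> \<omega> \<in> (carrier G \<times> carrier G) \<rightarrow>\<^sub>E mu n \<and>
     (\<forall>g1\<in>carrier G. \<forall>g2\<in>carrier G. \<forall>g3\<in>carrier G.
        \<omega> (g2, g3) * inverse (\<omega> (g1 \<otimes>\<^bsub>G\<^esub> g2, g3)) *
        \<omega> (g1, g2 \<otimes>\<^bsub>G\<^esub> g3) * inverse (\<omega> (g1, g2)) = 1)"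
  by (simp only: Z2_def mem_Collect_eq)

lemma Z2_inverse:
  assumes "group G" "\<omega> \<in> Z2 n G"
  shows "(\<lambda>p\<in>carrier G \<times> carrier G. inverse (\<omega> p)) \<in> Z2 n G" (is "?w \<in> _")
  unfolding Z2_iff
proof (intro conjI ballI)
  interpret group G by fact
  show "?w \<in> (carrier G \<times> carrier G) \<rightarrow>\<^sub>E mu n"
    using assms(2) unfolding Z2_iff by (fastforce simp: mu_closed PiE_iff)
  fix g1 g2 g3 assume g: "g1 \<in> carrier G" "g2 \<in> carrier G" "g3 \<in> carrier G"
  have "inverse a * inverse (inverse b) * inverse c * inverse (inverse d) = 1"
    if "a * inverse b * c * inverse d = 1" for a b c d :: complex
    using that by (metis inverse_1 inverse_mult_distrib)
  moreover have "\<omega> (g2, g3) * inverse (\<omega> (g1 \<otimes>\<^bsub>G\<^esub> g2, g3)) *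
      \<omega> (g1, g2 \<otimes>\<^bsub>G\<^esub> g3) * inverse (\<omega> (g1, g2)) = 1"
    using assms(2) g unfolding Z2_iff by blast
  ultimately show "?w (g2, g3) * inverse (?w (g1 \<otimes>\<^bsub>G\<^esub> g2, g3)) *
      ?w (g1, g2 \<otimes>\<^bsub>G\<^esub> g3) * inverse (?w (g1, g2)) = 1"
    using g by (simp only: restrict_apply' mem_Sigma_iff m_closed simp_thms)
qed

lemma Z2_mult:
  assumes "group G" "\<omega> \<in> Z2 n G" "\<omega>' \<in> Z2 n G"
  shows "(\<lambda>p\<in>carrier G \<times> carrier G. \<omega> p * \<omega>' p) \<in> Z2 n G" (is "?w \<in> _")
  unfolding Z2_iff
proof (intro conjI ballI)
  interpret group G by fact
  show "?w \<in> (carrier G \<times> carrier G) \<rightarrow>\<^sub>E mu n"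
  proof (rule PiE_I)
    fix p assume p: "p \<in> carrier G \<times> carrier G"
    have "\<omega> p \<in> mu n" "\<omega>' p \<in> mu n"
      using assms(2,3) p unfolding Z2_iff by (blast dest: PiE_mem)+
    then show "?w p \<in> mu n"
      using p by (simp add: mu_closed del: mem_Sigma_iff)
  qed (simp add: restrict_def)
  fix g1 g2 g3 assume g: "g1 \<in> carrier G" "g2 \<in> carrier G" "g3 \<in> carrier G"
  have "(a * a') * inverse (b * b') * (c * c') * inverse (d * d') = 1"
    if "a * inverse b * c * inverse d = 1" "a' * inverse b' * c' * inverse d' = 1"
    for a b c d a' b' c' d' :: complex
  proof -
    have "(a * a') * inverse (b * b') * (c * c') * inverse (d * d') =
          (a * inverse b * c * inverse d) * (a' * inverse b' * c' * inverse d')"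
      by (simp add: mult_ac)
    then show ?thesis by (simp only: that mult_1)
  qed
  moreover have "\<omega> (g2, g3) * inverse (\<omega> (g1 \<otimes>\<^bsub>G\<^esub> g2, g3)) *
      \<omega> (g1, g2 \<otimes>\<^bsub>G\<^esub> g3) * inverse (\<omega> (g1, g2)) = 1"
    using assms(2) g unfolding Z2_iff by blast
  moreover have "\<omega>' (g2, g3) * inverse (\<omega>' (g1 \<otimes>\<^bsub>G\<^esub> g2, g3)) *
      \<omega>' (g1, g2 \<otimes>\<^bsub>G\<^esub> g3) * inverse (\<omega>' (g1, g2)) = 1"
    using assms(3) g unfolding Z2_iff by blast
  ultimately show "?w (g2, g3) * inverse (?w (g1 \<otimes>\<^bsub>G\<^esub> g2, g3)) *
      ?w (g1, g2 \<otimes>\<^bsub>G\<^esub> g3) * inverse (?w (g1, g2)) = 1"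
    using g by (simp only: restrict_apply' mem_Sigma_iff m_closed simp_thms)
qed

proposition comm_group_Z2:
  assumes "group G" "1 \<le> n"
  shows "comm_group (Z2_group n G)" (is "comm_group ?Z")
proof (rule comm_groupI)
  interpret group G by fact
  show "\<one>\<^bsub>?Z\<^esub> \<in> carrier ?Z"
    by (auto simp: Z2_group_def Z2_def one_in_mu)
  fix \<omega> assume w: "\<omega> \<in> carrier ?Z"
  then have pie: "\<omega> \<in> (carrier G \<times> carrier G) \<rightarrow>\<^sub>E mu n"
    by (simp add: Z2_group_def Z2_iff)
  then have ext: "\<omega> \<in> extensional (carrier G \<times> carrier G)"
    by (simp add: PiE_iff)
  have nz: "\<omega> p \<noteq> 0" if "p \<in> carrier G \<times> carrier G" for p
    using pie that assms(2) by (intro mu_nonzero[of n]) (auto simp only: PiE_iff)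
  show "\<one>\<^bsub>?Z\<^esub> \<otimes>\<^bsub>?Z\<^esub> \<omega> = \<omega>"
    using ext by (simp add: Z2_group_def fun_eq_iff extensional_def)
  show "\<exists>\<omega>'\<in>carrier ?Z. \<omega>' \<otimes>\<^bsub>?Z\<^esub> \<omega> = \<one>\<^bsub>?Z\<^esub>"
    using Z2_inverse[OF assms(1), of \<omega> n] w nz
    by (intro bexI[of _ "\<lambda>p\<in>carrier G \<times> carrier G. inverse (\<omega> p)"])
      (auto simp: Z2_group_def fun_eq_iff)
next
  fix \<omega> \<omega>' assume "\<omega> \<in> carrier ?Z" "\<omega>' \<in> carrier ?Z"
  then show "\<omega> \<otimes>\<^bsub>?Z\<^esub> \<omega>' \<in> carrier ?Z"
    using assms(1) by (simp add: Z2_group_def Z2_mult)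
qed (auto simp: Z2_group_def fun_eq_iff mult_ac)

lemma coboundary_in_Z2:
  assumes "group G" "1 \<le> n" "c \<in> carrier G \<rightarrow> mu n"
  shows "coboundary G c \<in> Z2 n G"
proof -
  interpret group G by fact
  have nz: "c g \<noteq> 0" if "g \<in> carrier G" for g
    using mu_nonzero[OF assms(2), of "c g"] assms(3) that by (auto simp: Pi_iff)
  have "coboundary G c \<in> (carrier G \<times> carrier G) \<rightarrow>\<^sub>E mu n"
    using assms(3) by (auto simp: coboundary_def Pi_iff intro!: PiE_I mu_closed)
  moreover have "coboundary G c (g2, g3) * inverse (coboundary G c (g1 \<otimes>\<^bsub>G\<^esub> g2, g3)) *
      coboundary G c (g1, g2 \<otimes>\<^bsub>G\<^esub> g3) * inverse (coboundary G c (g1, g2)) = 1"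
    if "g1 \<in> carrier G" "g2 \<in> carrier G" "g3 \<in> carrier G" for g1 g2 g3
  proof -
    have "(c3 * inverse c23 * c2) * inverse (c3 * inverse c123 * c12) *
        (c23 * inverse c123 * c1) * inverse (c2 * inverse c12 * c1) = 1"
      if "c1 \<noteq> 0" "c2 \<noteq> 0" "c3 \<noteq> 0" "c12 \<noteq> 0" "c23 \<noteq> 0" "c123 \<noteq> 0"
      for c1 c2 c3 c12 c23 c123 :: complex
      using that by (simp add: field_simps)
    moreover have "c g1 \<noteq> 0" "c g2 \<noteq> 0" "c g3 \<noteq> 0" "c (g1 \<otimes>\<^bsub>G\<^esub> g2) \<noteq> 0"
      "c (g2 \<otimes>\<^bsub>G\<^esub> g3) \<noteq> 0" "c (g1 \<otimes>\<^bsub>G\<^esub> (g2 \<otimes>\<^bsub>G\<^esub> g3)) \<noteq> 0"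
      using that by (simp_all add: nz)
    ultimately show ?thesis
      using that by (simp only: coboundary_def restrict_apply' mem_Sigma_iff m_closed simp_thms
          m_assoc case_prod_conv)
  qed
  ultimately show ?thesis
    unfolding Z2_iff by blast
qed

proposition subgroup_B2:
  assumes "group G" "1 \<le> n"
  shows "subgroup (B2 n G) (Z2_group n G)" (is "subgroup _ ?Z")
proof -
  interpret g: group G by fact
  interpret comm_group ?Z by (rule comm_group_Z2[OF assms])
  have mult: "coboundary G c \<otimes>\<^bsub>?Z\<^esub> coboundary G d = coboundary G (\<lambda>g. c g * d g)" for c d
    by (auto simp: Z2_group_def coboundary_def fun_eq_iff)
  have one: "coboundary G (\<lambda>_. 1) = \<one>\<^bsub>?Z\<^esub>"
    by (auto simp: Z2_group_def coboundary_def fun_eq_iff)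
  have cl: "coboundary G c \<in> carrier ?Z" if "c \<in> carrier G \<rightarrow> mu n" for c
    using coboundary_in_Z2[OF assms that] by (simp add: Z2_group_def)
  have nz: "c g \<noteq> 0" if "c \<in> carrier G \<rightarrow> mu n" "g \<in> carrier G" for c g
    using mu_nonzero[OF assms(2), of "c g"] that by (auto simp: Pi_iff)
  have inv: "inv\<^bsub>?Z\<^esub> (coboundary G c) = coboundary G (\<lambda>g. inverse (c g))"
    if c: "c \<in> carrier G \<rightarrow> mu n" for c
  proof (rule inv_equality)
    have "coboundary G (\<lambda>g. inverse (c g) * c g) = coboundary G (\<lambda>_. 1)"
      using nz[OF c] by (auto simp: coboundary_def fun_eq_iff)
    then show "coboundary G (\<lambda>g. inverse (c g)) \<otimes>\<^bsub>?Z\<^esub> coboundary G c = \<one>\<^bsub>?Z\<^esub>"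
      by (simp add: mult one)
    show "coboundary G (\<lambda>g. inverse (c g)) \<in> carrier ?Z" "coboundary G c \<in> carrier ?Z"
      using c by (auto intro!: cl simp: mu_closed Pi_iff)
  qed
  show ?thesis
  proof (rule subgroupI)
    show "B2 n G \<subseteq> carrier ?Z" using cl by (auto simp: B2_def)
    have "(\<lambda>_. 1) \<in> carrier G \<rightarrow> mu n" by (simp add: one_in_mu)
    then show "B2 n G \<noteq> {}" unfolding B2_def by blast
  next
    fix b assume "b \<in> B2 n G"
    then obtain c where c: "c \<in> carrier G \<rightarrow> mu n" "b = coboundary G c"
      by (auto simp: B2_def)
    then have "(\<lambda>g. inverse (c g)) \<in> carrier G \<rightarrow> mu n" by (auto simp: mu_closed Pi_iff)
    then show "inv\<^bsub>?Z\<^esub> b \<in> B2 n G" using c by (auto simp: inv B2_def)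
  next
    fix b b' assume "b \<in> B2 n G" "b' \<in> B2 n G"
    then obtain c c' where c: "c \<in> carrier G \<rightarrow> mu n" "b = coboundary G c"
      "c' \<in> carrier G \<rightarrow> mu n" "b' = coboundary G c'"
      by (auto simp: B2_def)
    then have "(\<lambda>g. c g * c' g) \<in> carrier G \<rightarrow> mu n" by (auto simp: mu_closed Pi_iff)
    then show "b \<otimes>\<^bsub>?Z\<^esub> b' \<in> B2 n G" using c by (auto simp: mult B2_def)
  qed
qed

end

theory Submission
  imports Defs
begin

text \<open>Each of the three sets of matrices is described by a factorization. Say that a matrix \<open>A\<close> of
  roots of unity and zeros with support \<open>\<O>\<close> has cocyclic form \<open>\<omega>\<close> if
  \<open>A x y = l x * f (x\<^sup>-\<^sup>1 y) * \<omega> (x\<^sup>-\<^sup>1, y) * r y\<close> on \<open>\<O>\<close>, with \<open>l\<close>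
  and \<open>r\<close> valued in the roots of unity. Such factorizations multiply and invert entrywise, and \<open>A\<close>
  has one for \<open>\<omega>\<close> exactly when it is D-equivalent to a cocyclic matrix built from \<open>\<omega>\<close>.

  The matrices in \<open>h0\<close> are those of cocyclic form \<open>1\<close>, since a \<open>G\<close>-invariant matrix is a function of
  \<open>x\<^sup>-\<^sup>1 y\<close>. A matrix in \<open>h1\<close> also has this form: its monomial symmetries give
  \<open>A x y = p\<^sub>g x * A (g\<^sup>-\<^sup>1 x) (g\<^sup>-\<^sup>1 y) * r\<^sub>g y\<close>, the choice \<open>g = x\<close> expresses every entry by one in the
  row of the identity, and the homomorphism property splits \<open>r\<^sub>x y\<close> into a function of \<open>y\<close> and one of
  \<open>x\<^sup>-\<^sup>1 y\<close>. Conversely, permutation matrices conjugated by diagonal scalings are monomial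
  symmetries. Hence \<open>h0 = h1\<close>.

  For \<open>A\<close> in \<open>h2\<close> there are only scalings \<open>l\<^sub>g\<close> and \<open>r\<^sub>g\<close> for each \<open>g\<close> separately. Irreducibility makes
  them unique up to a scalar (\<open>irreducible_const\<close>). So \<open>l\<^sub>g\<close> can be normalized at the identity, and
  \<open>l\<^sub>g x * l\<^sub>h (g\<^sup>-\<^sup>1 x)\<close> differs from \<open>l\<^sub>g\<^sub>h x\<close> by a factor \<open>\<omega> (g, h)\<close> that does not depend on \<open>x\<close>. At the
  identity this reads \<open>\<omega> (g, h) = l\<^sub>h (g\<^sup>-\<^sup>1)\<close>, and then the relation at arbitrary \<open>x\<close> is the cocycle
  identity. The choice \<open>g = x\<close> again yields the cocyclic form \<open>\<omega>\<close> (\<open>h2_cocyclic_formE\<close>).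
  Conversely, the cocycle identity shows that every matrix of cocyclic form \<open>\<omega>\<close> lies in \<open>h2\<close>, so \<open>h2\<close>
  is the closure of the cocyclic matrices.

  For the isomorphism, \<open>\<omega>\<close> is sent to the class of its pure cocyclic matrix. This is onto, because
  dividing a matrix of form \<open>\<omega>\<close> by the pure cocyclic one leaves form \<open>1\<close>. The kernel consists of the
  \<open>\<omega>\<close> for which the all-one matrix has form \<open>\<omega>\<close>, and by irreducibility these are the coboundaries
  (\<open>coboundary_if_cocyclic_form_one\<close>).\<close>

section \<open>Roots of unity and cocycles\<close>

lemma norm_mu:
  assumes "1 \<le> n" "z \<in> mu n"
  shows "cmod z = 1"
proof -
  have "cmod z ^ n = 1"
    using assms(2) by (simp add: mu_def flip: norm_power)
  then show ?thesis
    using assms(1) power_eq_1_iff[of "cmod z" n] by auto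
qed

lemma mu_divide: "a \<in> mu n \<Longrightarrow> b \<in> mu n \<Longrightarrow> a / b \<in> mu n"
  by (simp add: mu_closed divide_inverse)

lemma Z2_in_mu: "\<omega> \<in> Z2 n G \<Longrightarrow> g \<in> carrier G \<Longrightarrow> h \<in> carrier G \<Longrightarrow> \<omega> (g, h) \<in> mu n"
  unfolding Z2_iff by blast

lemma Z2_cocycle:
  assumes "1 \<le> n" "group G" "\<omega> \<in> Z2 n G" "g \<in> carrier G" "h \<in> carrier G" "k \<in> carrier G"
  shows "\<omega> (g, h) * \<omega> (g \<otimes>\<^bsub>G\<^esub> h, k) = \<omega> (h, k) * \<omega> (g, h \<otimes>\<^bsub>G\<^esub> k)"
proof -
  interpret group G by fact
  have "\<omega> (h, k) * inverse (\<omega> (g \<otimes>\<^bsub>G\<^esub> h, k)) * \<omega> (g, h \<otimes>\<^bsub>G\<^esub> k) * inverse (\<omega> (g, h)) = 1"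
    using assms unfolding Z2_iff by blast
  moreover have "\<omega> (g, h) \<noteq> 0" "\<omega> (g \<otimes>\<^bsub>G\<^esub> h, k) \<noteq> 0"
    using assms by (auto intro!: mu_nonzero[OF assms(1)] Z2_in_mu)
  ultimately show ?thesis
    by (simp add: field_simps)
qed

lemma Z2I:
  assumes "1 \<le> n" "group G"
    and "\<And>g h. g \<in> carrier G \<Longrightarrow> h \<in> carrier G \<Longrightarrow> w g h \<in> mu n"
    and "\<And>g h k. g \<in> carrier G \<Longrightarrow> h \<in> carrier G \<Longrightarrow> k \<in> carrier G \<Longrightarrow>
           w g h * w (g \<otimes>\<^bsub>G\<^esub> h) k = w h k * w g (h \<otimes>\<^bsub>G\<^esub> k)"
  shows "(\<lambda>(g, h)\<in>carrier G \<times> carrier G. w g h) \<in> Z2 n G"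
proof -
  interpret group G by fact
  have nz: "w g h \<noteq> 0" if "g \<in> carrier G" "h \<in> carrier G" for g h
    using mu_nonzero[OF assms(1) assms(3)[OF that]] .
  have "w h k * inverse (w (g \<otimes>\<^bsub>G\<^esub> h) k) * w g (h \<otimes>\<^bsub>G\<^esub> k) * inverse (w g h) = 1"
    if "g \<in> carrier G" "h \<in> carrier G" "k \<in> carrier G" for g h k
    using assms(4)[OF that] nz[of g h] nz[of "g \<otimes>\<^bsub>G\<^esub> h" k] nz[of h k]
      nz[of g "h \<otimes>\<^bsub>G\<^esub> k"] that by (simp add: field_simps)
  then show ?thesis
    unfolding Z2_iff using assms(3) by (auto intro!: PiE_I)
qed

section \<open>Matrices carried by the graph of a permutation\<close>

lemma mmul_single_entry:
  assumes "finite X" "b \<in> X" "\<And>y. y \<in> X \<Longrightarrow> y \<noteq> b \<Longrightarrow> P x y = 0"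
  shows "mmul X P M x z = P x b * M b z"
proof -
  have "(\<Sum>y\<in>X. P x y * M y z) = (\<Sum>y\<in>X. if y = b then P x b * M b z else 0)"
    by (rule sum.cong) (use assms(3) in auto)
  then show ?thesis
    using assms(1,2) by (simp add: mmul_def)
qed

text \<open>Row \<open>x\<close> of \<open>P\<close> and row \<open>y\<close> of \<open>Q\<close> have at most one nonzero entry each, so one term of the
  double sum survives.\<close>

lemma conjugate_single_entry:
  assumes "finite X" "b \<in> X" "\<And>x'. x' \<in> X \<Longrightarrow> x' \<noteq> b \<Longrightarrow> P x x' = 0"
    and "finite Y" "c \<in> Y" "\<And>y'. y' \<in> Y \<Longrightarrow> y' \<noteq> c \<Longrightarrow> Q y y' = 0"
  shows "mmul X P (mmul Y A (adj Q)) x y = P x b * A b c * cnj (Q y c)"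
proof -
  have "(\<Sum>y'\<in>Y. A b y' * cnj (Q y y')) = (\<Sum>y'\<in>Y. if y' = c then A b c * cnj (Q y c) else 0)"
    by (rule sum.cong) (use assms(6) in auto)
  then have "mmul Y A (adj Q) b y = A b c * cnj (Q y c)"
    using assms(4,5) by (simp add: mmul_def adj_def)
  then show ?thesis
    using mmul_single_entry[of X b P x "mmul Y A (adj Q)" y, OF assms(1-3)]
    by (simp add: mult.assoc)
qed

section \<open>Rigidity on an irreducible support\<close>

text \<open>Along an edge \<open>(x, y)\<close> the value \<open>u x\<close> equals the inverse of \<open>v y\<close>, so \<open>u\<close> and the inverse of \<open>v\<close>
  together form a function on the vertices of a connected graph that is constant along edges.
  Applied to the quotient of two diagonal scalings, this says that the scaling which relates two
  matrices of support \<open>\<O>\<close> is unique up to a scalar.\<close>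

lemma irreducible_const:
  fixes u :: "'x \<Rightarrow> complex" and v :: "'y \<Rightarrow> complex"
  assumes irr: "irreducible_set X Y \<O>"
    and uv: "\<And>x y. (x, y) \<in> \<O> \<Longrightarrow> u x * v y = 1"
    and x: "x \<in> X" "x' \<in> X"
  shows "u x = u x'"
proof -
  define F where "F = case_sum u (\<lambda>y. inverse (v y))"
  have edge: "F a = F b" if "(a, b) \<in> bip_edges \<O>" for a b
    using that uv inverse_unique by (fastforce simp: bip_edges_def F_def mult.commute)
  have "(Inl x, Inl x') \<in> (bip_edges \<O>)\<^sup>*"
    using irr x by (auto simp: irreducible_set_def)
  then have "F (Inl x) = F (Inl x')"
    by (induction rule: rtrancl_induct) (auto dest: edge)
  then show ?thesis by (simp add: F_def)
qed

section \<open>Cocyclic form\<close>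

lemma supp_eq_0_iff: "supp A = \<O> \<Longrightarrow> A x y = 0 \<longleftrightarrow> (x, y) \<notin> \<O>"
  by (auto simp: supp_def)

locale regular_support = group G for G (structure) +
  fixes n :: nat and \<O> :: "('a \<times> 'a) set"
  assumes fin: "finite (carrier G)" and n: "1 \<le> n"
    and sub: "\<O> \<subseteq> carrier G \<times> carrier G"
    and stable: "stable_set G (left_mult G) (left_mult G) \<O>"
    and irr: "irreducible_set (carrier G) (carrier G) \<O>"
begin

abbreviation "matsG \<equiv> mats n (carrier G) (carrier G)"
abbreviation "D_equivG \<equiv> D_equiv n (carrier G) (carrier G)"
abbreviation "actG \<equiv> act_mat G (carrier G) (left_mult G) (carrier G) (left_mult G)"
abbreviation "monomialG \<equiv> monomial_group n (carrier G)"
abbreviation "h2G \<equiv> h2 n G (carrier G) (left_mult G) (carrier G) (left_mult G) \<O>"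
abbreviation "h1G \<equiv> h1 n G (carrier G) (left_mult G) (carrier G) (left_mult G) \<O>"
abbreviation "h0G \<equiv> h0 n G (carrier G) (left_mult G) (carrier G) (left_mult G) \<O>"
abbreviation "h2G_group \<equiv> h2_group n G (carrier G) (left_mult G) (carrier G) (left_mult G) \<O>"

text \<open>The factor \<open>f (x\<^sup>-\<^sup>1 y)\<close> is the developed part. On \<open>\<O>\<close> it is determined by the other factors, so it is
  a root of unity there when the entries of \<open>A\<close> and \<open>\<omega>\<close> are.\<close>

definition cocyclic_form :: "('a \<times> 'a \<Rightarrow> complex) \<Rightarrow> ('a, 'a) cmat \<Rightarrow> bool" where
  "cocyclic_form \<omega> A \<longleftrightarrow> (\<exists>l\<in>carrier G \<rightarrow> mu n. \<exists>r\<in>carrier G \<rightarrow> mu n. \<exists>f. \<forall>x y. (x, y) \<in> \<O> \<longrightarrow>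
     A x y = l x * (f (inv x \<otimes> y) * \<omega> (inv x, y)) * r y)"

lemma cocyclic_formI:
  assumes "l \<in> carrier G \<rightarrow> mu n" "r \<in> carrier G \<rightarrow> mu n"
    and "\<And>x y. (x, y) \<in> \<O> \<Longrightarrow> A x y = l x * (f (inv x \<otimes> y) * \<omega> (inv x, y)) * r y"
  shows "cocyclic_form \<omega> A"
  using assms unfolding cocyclic_form_def by blast

lemma cocyclic_formE:
  assumes "cocyclic_form \<omega> A"
  obtains l r f where "l \<in> carrier G \<rightarrow> mu n" "r \<in> carrier G \<rightarrow> mu n"
    "\<And>x y. (x, y) \<in> \<O> \<Longrightarrow> A x y = l x * (f (inv x \<otimes> y) * \<omega> (inv x, y)) * r y"
  using assms unfolding cocyclic_form_def by blast

lemma supp_carrier: "(x, y) \<in> \<O> \<Longrightarrow> x \<in> carrier G" "(x, y) \<in> \<O> \<Longrightarrow> y \<in> carrier G"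
  using sub by auto

lemma translate_supp: "(x, y) \<in> \<O> \<Longrightarrow> g \<in> carrier G \<Longrightarrow> (g \<otimes> x, g \<otimes> y) \<in> \<O>"
  using stable supp_carrier by (fastforce simp: stable_set_def left_mult_def)

lemma cancel_left: "g \<in> carrier G \<Longrightarrow> x \<in> carrier G \<Longrightarrow> g \<otimes> (inv g \<otimes> x) = x"
   "g \<in> carrier G \<Longrightarrow> x \<in> carrier G \<Longrightarrow> inv g \<otimes> (g \<otimes> x) = x"
  by (simp_all flip: m_assoc)

lemma translate_supp_iff:
  assumes "g \<in> carrier G" "x \<in> carrier G" "y \<in> carrier G"
  shows "(g \<otimes> x, g \<otimes> y) \<in> \<O> \<longleftrightarrow> (x, y) \<in> \<O>"
  using translate_supp[of x y g] translate_supp[of "g \<otimes> x" "g \<otimes> y" "inv g"] assms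
  by (auto simp: cancel_left)

lemma inv_translate:
  assumes "g \<in> carrier G" "x \<in> carrier G" "y \<in> carrier G"
  shows "inv (inv g \<otimes> x) = inv x \<otimes> g" "(inv x \<otimes> g) \<otimes> (inv g \<otimes> y) = inv x \<otimes> y"
    "inv (inv g \<otimes> x) \<otimes> (inv g \<otimes> y) = inv x \<otimes> y"
  using assms by (simp_all add: inv_mult_group m_assoc cancel_left)

lemma cocycle_translate:
  assumes "\<omega> \<in> Z2 n G" "g \<in> carrier G" "x \<in> carrier G" "y \<in> carrier G"
  shows "\<omega> (inv x, g) * \<omega> (inv x \<otimes> g, inv g \<otimes> y) = \<omega> (g, inv g \<otimes> y) * \<omega> (inv x, y)"
  using Z2_cocycle[OF n is_group assms(1), of "inv x" g "inv g \<otimes> y"] assms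
  by (simp add: cancel_left)

lemma D_equivI:
  assumes "A \<in> matsG"
    and "l \<in> carrier G \<rightarrow> mu n" "r \<in> carrier G \<rightarrow> mu n"
    and "\<And>x y. x \<in> carrier G \<Longrightarrow> y \<in> carrier G \<Longrightarrow> A x y = l x * B x y * r y"
  shows "D_equivG A B"
  unfolding D_equiv_iff[OF fin fin n]
  by (rule bexI[OF _ assms(2)], rule bexI[OF _ assms(3)])
    (use assms(1,4) in \<open>auto simp: fun_eq_iff mats_def\<close>)

lemma D_equivE:
  assumes "D_equivG A B"
  obtains l r where "l \<in> carrier G \<rightarrow> mu n" "r \<in> carrier G \<rightarrow> mu n"
    "A = (\<lambda>x y. if (x, y) \<in> carrier G \<times> carrier G then l x * B x y * r y else 0)"
  using assms unfolding D_equiv_iff[OF fin fin n] by blast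

text \<open>A relation between entries on \<open>\<O>\<close> suffices for D-equivalence of \<open>A\<close> with its translate, because
  both matrices vanish off \<open>\<O>\<close>.\<close>

lemma h2_iff:
  "A \<in> h2G \<longleftrightarrow> A \<in> matsG \<and> supp A = \<O> \<and>
     (\<forall>g\<in>carrier G. \<exists>l\<in>carrier G \<rightarrow> mu n. \<exists>r\<in>carrier G \<rightarrow> mu n.
        \<forall>x y. (x, y) \<in> \<O> \<longrightarrow> A x y = l x * A (inv g \<otimes> x) (inv g \<otimes> y) * r y)"
proof -
  have "D_equivG A (actG g A)
      \<longleftrightarrow> (\<exists>l\<in>carrier G \<rightarrow> mu n. \<exists>r\<in>carrier G \<rightarrow> mu n.
        \<forall>x y. (x, y) \<in> \<O> \<longrightarrow> A x y = l x * A (inv g \<otimes> x) (inv g \<otimes> y) * r y)" (is "?D \<longleftrightarrow> ?R")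
    if A: "A \<in> matsG" "supp A = \<O>" and g: "g \<in> carrier G" for g
  proof
    assume ?D
    then obtain l r where lr: "l \<in> carrier G \<rightarrow> mu n" "r \<in> carrier G \<rightarrow> mu n"
      and eq: "A = (\<lambda>x y. if (x, y) \<in> carrier G \<times> carrier G then l x *
        actG g A x y * r y else 0)"
      by (rule D_equivE)
    have "A x y = l x * A (inv g \<otimes> x) (inv g \<otimes> y) * r y" if "(x, y) \<in> \<O>" for x y
      using fun_cong[OF fun_cong[OF eq, of x], of y] supp_carrier[OF that] g
      by (simp add: act_mat_def left_mult_def)
    then show ?R using lr by (intro bexI[of _ l] bexI[of _ r]) simp_all
  next
    assume ?R
    then obtain l r where lr: "l \<in> carrier G \<rightarrow> mu n" "r \<in> carrier G \<rightarrow> mu n"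
      and eq: "\<And>x y. (x, y) \<in> \<O> \<Longrightarrow> A x y = l x * A (inv g \<otimes> x) (inv g \<otimes> y) * r y"
      by blast
    show ?D
    proof (rule D_equivI[OF A(1) lr])
      fix x y assume xy: "x \<in> carrier G" "y \<in> carrier G"
      show "A x y = l x * actG g A x y * r y"
      proof (cases "(x, y) \<in> \<O>")
        case True
        then show ?thesis using eq[OF True] xy g by (simp add: act_mat_def left_mult_def)
      next
        case False
        then have "(inv g \<otimes> x, inv g \<otimes> y) \<notin> \<O>"
          using translate_supp_iff[of "inv g" x y] xy g by simp
        then show ?thesis
          using False xy g supp_eq_0_iff[OF A(2), of x y] supp_eq_0_iff[OF A(2), of "inv g \<otimes> x" "inv g \<otimes> y"]
          by (simp add: act_mat_def left_mult_def)
      qed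
    qed
  qed
  then show ?thesis unfolding h2_def by blast
qed

lemma h2_D: "A \<in> h2G \<Longrightarrow> A \<in> matsG" "A \<in> h2G \<Longrightarrow> supp A = \<O>"
  by (simp_all add: h2_def)

section \<open>Matrices stable up to D-equivalence are those of cocyclic form\<close>

text \<open>Translating by \<open>g\<close> keeps \<open>x\<^sup>-\<^sup>1 y\<close> and replaces \<open>\<omega> (x\<^sup>-\<^sup>1, y)\<close> by \<open>\<omega> (x\<^sup>-\<^sup>1 g, g\<^sup>-\<^sup>1 y)\<close>. The cocycle identity for
  \<open>x\<^sup>-\<^sup>1, g, g\<^sup>-\<^sup>1 y\<close> says that the first value is the second times \<open>\<omega> (x\<^sup>-\<^sup>1, g) / \<omega> (g, g\<^sup>-\<^sup>1 y)\<close>,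
  a row factor times a column factor.\<close>

lemma cocyclic_form_in_h2:
  assumes A: "A \<in> matsG" "supp A = \<O>"
    and w: "\<omega> \<in> Z2 n G" and form: "cocyclic_form \<omega> A"
  shows "A \<in> h2G"
proof -
  obtain l r f where lr: "l \<in> carrier G \<rightarrow> mu n" "r \<in> carrier G \<rightarrow> mu n"
    and eq: "\<And>x y. (x, y) \<in> \<O> \<Longrightarrow> A x y = l x * (f (inv x \<otimes> y) * \<omega> (inv x, y)) * r y"
    using form by (rule cocyclic_formE) blast
  have "\<exists>l'\<in>carrier G \<rightarrow> mu n. \<exists>r'\<in>carrier G \<rightarrow> mu n.
        \<forall>x y. (x, y) \<in> \<O> \<longrightarrow> A x y = l' x * A (inv g \<otimes> x) (inv g \<otimes> y) * r' y"
    if g: "g \<in> carrier G" for g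
  proof (rule bexI[of _ "\<lambda>x. l x / l (inv g \<otimes> x) * \<omega> (inv x, g)"],
      rule bexI[of _ "\<lambda>y. r y / r (inv g \<otimes> y) / \<omega> (g, inv g \<otimes> y)"], intro allI impI)
    show "(\<lambda>x. l x / l (inv g \<otimes> x) * \<omega> (inv x, g)) \<in> carrier G \<rightarrow> mu n"
      using lr g w by (auto intro!: mu_closed mu_divide Z2_in_mu[OF w] simp: Pi_iff)
    show "(\<lambda>y. r y / r (inv g \<otimes> y) / \<omega> (g, inv g \<otimes> y)) \<in> carrier G \<rightarrow> mu n"
      using lr g w by (auto intro!: mu_closed mu_divide Z2_in_mu[OF w] simp: Pi_iff)
    fix x y assume xy: "(x, y) \<in> \<O>"
    note c = supp_carrier[OF xy] g
    have nz: "l (inv g \<otimes> x) \<noteq> 0" "r (inv g \<otimes> y) \<noteq> 0" "\<omega> (g, inv g \<otimes> y) \<noteq> 0"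
      using lr c w by (auto intro!: mu_nonzero[OF n] Z2_in_mu[OF w] simp: Pi_iff)
    have "\<omega> (inv x, g) * \<omega> (inv x \<otimes> g, inv g \<otimes> y) = \<omega> (g, inv g \<otimes> y) * \<omega> (inv x, y)"
      using cocycle_translate[OF w] c by simp
    moreover have "A (inv g \<otimes> x) (inv g \<otimes> y) = l (inv g \<otimes> x) *
        (f (inv x \<otimes> y) * \<omega> (inv x \<otimes> g, inv g \<otimes> y)) * r (inv g \<otimes> y)"
      using eq[OF translate_supp[OF xy, of "inv g"]] c by (simp add: inv_translate)
    ultimately show "A x y = (l x / l (inv g \<otimes> x) * \<omega> (inv x, g)) * A (inv g \<otimes> x) (inv g \<otimes> y)
        * (r y / r (inv g \<otimes> y) / \<omega> (g, inv g \<otimes> y))"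
      using nz by (simp add: eq[OF xy] field_simps)
  qed
  then show ?thesis unfolding h2_iff using A by blast
qed

text \<open>The cocycle measures how far the scalings of \<open>A\<close> under \<open>g\<close> and \<open>h\<close> are from composing to the
  scaling under \<open>g h\<close>. The normalization \<open>l g \<one> = 1\<close> identifies its values with the
  explicit expression \<open>l h (g\<^sup>-\<^sup>1)\<close>, which makes the cocycle identity an instance of the composition
  rule at an arbitrary point.\<close>

lemma h2_cocyclic_formE:
  assumes A: "A \<in> h2G"
  obtains \<omega> where "\<omega> \<in> Z2 n G" "cocyclic_form \<omega> A"
proof -
  note A' = h2_D[OF A]
  have "\<forall>g\<in>carrier G. \<exists>l r. l \<in> carrier G \<rightarrow> mu n \<and> r \<in> carrier G \<rightarrow> mu n \<and>
     (\<forall>x y. (x, y) \<in> \<O> \<longrightarrow> A x y = l x * A (inv g \<otimes> x) (inv g \<otimes> y) * r y)"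
    using A unfolding h2_iff by blast
  then obtain l0 r0 where l0: "\<And>g x. g \<in> carrier G \<Longrightarrow> x \<in> carrier G \<Longrightarrow> l0 g x \<in> mu n"
    and r0: "\<And>g x. g \<in> carrier G \<Longrightarrow> x \<in> carrier G \<Longrightarrow> r0 g x \<in> mu n"
    and eq0: "\<And>g x y. g \<in> carrier G \<Longrightarrow> (x, y) \<in> \<O> \<Longrightarrow>
       A x y = l0 g x * A (inv g \<otimes> x) (inv g \<otimes> y) * r0 g y"
    unfolding Pi_iff by metis
  define l where "l g x = l0 g x / l0 g \<one>" for g x
  define r where "r g y = r0 g y * l0 g \<one>" for g y
  have l: "l g x \<in> mu n" and r: "r g x \<in> mu n" if "g \<in> carrier G" "x \<in> carrier G" for g x
    using that by (auto simp: l_def r_def intro!: mu_closed mu_divide l0 r0)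
  have nz: "l g x \<noteq> 0" "r g x \<noteq> 0" if "g \<in> carrier G" "x \<in> carrier G" for g x
    using mu_nonzero[OF n l[OF that]] mu_nonzero[OF n r[OF that]] .
  have l1: "l g \<one> = 1" if "g \<in> carrier G" for g
    using mu_nonzero[OF n l0[OF that one_closed]] by (simp add: l_def)
  have eq: "A x y = l g x * A (inv g \<otimes> x) (inv g \<otimes> y) * r g y"
    if "g \<in> carrier G" "(x, y) \<in> \<O>" for g x y
    using eq0[OF that] mu_nonzero[OF n l0[OF that(1) one_closed]] by (simp add: l_def r_def)
  \<comment> \<open>Both sides scale the translate of \<open>A\<close> by \<open>g h\<close> to \<open>A\<close>: in two steps and in one.\<close>
  have comp: "l g x * l h (inv g \<otimes> x) * (r g y * r h (inv g \<otimes> y))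
      = l (g \<otimes> h) x * r (g \<otimes> h) y" if gh: "g \<in> carrier G" "h \<in> carrier G" and xy: "(x, y) \<in> \<O>" for g h x y
  proof -
    note c = supp_carrier[OF xy] gh
    have "inv h \<otimes> (inv g \<otimes> x) = inv (g \<otimes> h) \<otimes> x" "inv h \<otimes> (inv g \<otimes> y) = inv (g \<otimes> h) \<otimes> y"
      using c by (simp_all add: inv_mult_group m_assoc)
    moreover have "A (inv (g \<otimes> h) \<otimes> x) (inv (g \<otimes> h) \<otimes> y) \<noteq> 0"
      using translate_supp[OF xy, of "inv (g \<otimes> h)"] c by (simp add: supp_eq_0_iff[OF A'(2)])
    ultimately show ?thesis
      using eq[OF gh(1) xy] eq[OF gh(2) translate_supp[OF xy, of "inv g"]] eq[of "g \<otimes> h", OF _ xy] c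
      by (simp add: mult_ac)
  qed
  define w where "w g h = l h (inv g)" for g h
  \<comment> \<open>By rigidity the ratio is independent of \<open>x\<close>; at \<open>x = \<one>\<close> it equals \<open>l h (inv g)\<close>.\<close>
  have lw: "l g x * l h (inv g \<otimes> x) = w g h * l (g \<otimes> h) x"
    if gh: "g \<in> carrier G" "h \<in> carrier G" and x: "x \<in> carrier G" for g h x
  proof -
    have "l g x * l h (inv g \<otimes> x) / l (g \<otimes> h) x
        = l g \<one> * l h (inv g \<otimes> \<one>) / l (g \<otimes> h) \<one>"
    proof (rule irreducible_const[OF irr, where v = "\<lambda>y. r g y * r h (inv g \<otimes> y) / r (g \<otimes> h) y"])
      fix x y assume xy: "(x, y) \<in> \<O>"
      show "l g x * l h (inv g \<otimes> x) / l (g \<otimes> h) x * (r g y * r h (inv g \<otimes> y) / r (g \<otimes> h) y) = 1"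
        using comp[OF gh xy] nz gh supp_carrier[OF xy] by (simp add: field_simps)
    qed (use x in auto)
    then show ?thesis
      using gh x nz[of "g \<otimes> h" x] by (simp add: l1 w_def field_simps)
  qed
  have w: "(\<lambda>(g, h)\<in>carrier G \<times> carrier G. w g h) \<in> Z2 n G"
  proof (rule Z2I[OF n is_group])
    show "w g h \<in> mu n" if "g \<in> carrier G" "h \<in> carrier G" for g h
      using that by (auto simp: w_def intro: l)
    fix g h k assume c: "g \<in> carrier G" "h \<in> carrier G" "k \<in> carrier G"
    \<comment> \<open>the relation \<open>lw\<close> for \<open>h\<close> and \<open>k\<close> at the point \<open>inv g\<close>\<close>
    show "w g h * w (g \<otimes> h) k = w h k * w g (h \<otimes> k)"
      using lw[of h k "inv g"] c by (simp add: w_def inv_mult_group)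
  qed
  moreover have "cocyclic_form (\<lambda>(g, h)\<in>carrier G \<times> carrier G. w g h) A"
  proof (rule cocyclic_formI)
    show "(\<lambda>_. 1) \<in> carrier G \<rightarrow> mu n" "(\<lambda>y. r y y) \<in> carrier G \<rightarrow> mu n"
      using r by (auto simp: one_in_mu)
    fix x y assume xy: "(x, y) \<in> \<O>"
    define z where "z = inv x \<otimes> y"
    note c = supp_carrier[OF xy]
    have z: "z \<in> carrier G" "x \<otimes> z = y" using c by (simp_all add: z_def cancel_left)
    have nw: "w g h \<noteq> 0" if "g \<in> carrier G" "h \<in> carrier G" for g h
      using that by (simp add: w_def nz)
    \<comment> \<open>Since \<open>y = x z\<close>, the column scalings of \<open>x\<close> and \<open>z\<close> compose to that of \<open>y\<close>; this
      trades \<open>r x y\<close> for a function of \<open>y\<close>, a function of \<open>z\<close> and a value of the cocycle.\<close>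
    have "w x z * l y x * (r x y * r z z) = l y x * r y y"
      using comp[OF c(1) z(1) xy] lw[OF c(1) z(1) c(1)] z by (simp add: z_def[symmetric] mult_ac)
    then have ry: "r y y = w x z * r x y * r z z"
      using nz[OF c(2,1)] by (simp add: mult_ac)
    have cc: "w (inv x) x * w \<one> z = w x z * w (inv x) y"
      using Z2_cocycle[OF n is_group w, of "inv x" x z] c z by simp
    have "A x y = w (inv x) x * A \<one> z * r x y"
      using eq[OF c(1) xy] c by (simp add: w_def z_def)
    also have "\<dots> = 1 * (A \<one> z / (r z z * w \<one> z) * w (inv x) y) * r y y"
      using cc nz[OF z(1,1)] nw[OF one_closed z(1)] by (simp add: ry field_simps)
    finally show "A x y = 1 * ((\<lambda>z. A \<one> z / (r z z * w \<one> z)) (inv x \<otimes> y) *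
        (\<lambda>(g, h)\<in>carrier G \<times> carrier G. w g h) (inv x, y)) * r y y"
      using c by (simp add: z_def)
  qed
  ultimately show ?thesis by (rule that)
qed

text \<open>Comparing the factorization of the all-one matrix at \<open>(x, y)\<close> and at its translate by \<open>g\<close> removes
  \<open>f\<close>, and by rigidity the row factor \<open>l x / l (g\<^sup>-\<^sup>1 x) * \<omega> (x\<^sup>-\<^sup>1, g)\<close> depends on \<open>g\<close> only. So \<open>\<omega> (h, g)\<close> is
  \<open>c g * m (h g) / m h\<close> with \<open>m h = l (h\<^sup>-\<^sup>1)\<close>. The cocycle identity then forces \<open>c * m\<close> to be constant,
  and eliminating \<open>m\<close> leaves the coboundary of \<open>c\<close>.\<close>

lemma coboundary_if_cocyclic_form_one:
  assumes w: "\<omega> \<in> Z2 n G" and "cocyclic_form \<omega> (\<lambda>x y. 1)"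
  shows "\<omega> \<in> B2 n G"
proof -
  obtain l r f where lr: "l \<in> carrier G \<rightarrow> mu n" "r \<in> carrier G \<rightarrow> mu n"
    and eq: "\<And>x y. (x, y) \<in> \<O> \<Longrightarrow> 1 = l x * (f (inv x \<otimes> y) * \<omega> (inv x, y)) * r y"
    using assms(2) by (rule cocyclic_formE) blast
  have nzl: "l x \<noteq> 0" "r x \<noteq> 0" if "x \<in> carrier G" for x
    using lr that by (auto intro!: mu_nonzero[OF n] simp: Pi_iff)
  have nzw: "\<omega> (g, h) \<noteq> 0" if "g \<in> carrier G" "h \<in> carrier G" for g h
    using w that by (auto intro!: mu_nonzero[OF n] Z2_in_mu)
  define m where "m x = l (inv x)" for x
  define c where "c g = m \<one> / m g * \<omega> (\<one>, g)" for g
  have m: "m x \<noteq> 0" "m x \<in> mu n" if "x \<in> carrier G" for x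
    using that nzl lr by (auto simp: m_def)
  have wc: "\<omega> (h, g) = c g * m (h \<otimes> g) / m h" if h: "h \<in> carrier G" and g: "g \<in> carrier G" for g h
  proof -
    have "l (inv h) / l (inv g \<otimes> inv h) * \<omega> (inv (inv h), g)
        = l \<one> / l (inv g \<otimes> \<one>) * \<omega> (inv \<one>, g)"
    proof (rule irreducible_const[OF irr, where v = "\<lambda>y. r y / r (inv g \<otimes> y) / \<omega> (g, inv g \<otimes> y)"])
      fix x y assume xy: "(x, y) \<in> \<O>"
      note k = supp_carrier[OF xy] g
      have "\<omega> (inv x, g) * \<omega> (inv x \<otimes> g, inv g \<otimes> y) = \<omega> (g, inv g \<otimes> y) * \<omega> (inv x, y)"
        using cocycle_translate[OF w] k by simp
      then have wg: "\<omega> (inv x, g) / \<omega> (g, inv g \<otimes> y) = \<omega> (inv x, y) / \<omega> (inv x \<otimes> g, inv g \<otimes> y)"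
        using k nzw by (simp add: field_simps)
      have "1 = l (inv g \<otimes> x) *
        (f (inv x \<otimes> y) * \<omega> (inv x \<otimes> g, inv g \<otimes> y)) * r (inv g \<otimes> y)"
        using eq[OF translate_supp[OF xy, of "inv g"]] k by (simp add: inv_translate)
      with eq[OF xy] have "l x * (f (inv x \<otimes> y) * \<omega> (inv x, y)) * r y = l (inv g \<otimes> x) *
        (f (inv x \<otimes> y) * \<omega> (inv x \<otimes> g, inv g \<otimes> y)) * r (inv g \<otimes> y)" by simp
      moreover have "f (inv x \<otimes> y) \<noteq> 0" using eq[OF xy] by auto
      ultimately have "l x * \<omega> (inv x, y) * r y = l (inv g \<otimes> x) * \<omega> (inv x \<otimes> g, inv g \<otimes> y) * r (inv g \<otimes> y)"
        by (simp add: mult_ac)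
      then have "l x / l (inv g \<otimes> x) * (r y / r (inv g \<otimes> y)) *
          (\<omega> (inv x, y) / \<omega> (inv x \<otimes> g, inv g \<otimes> y)) = 1"
        using k nzl nzw by (simp add: field_simps)
      then show "l x / l (inv g \<otimes> x) * \<omega> (inv x, g) * (r y / r (inv g \<otimes> y) / \<omega> (g, inv g \<otimes> y)) = 1"
        unfolding wg[symmetric] by (simp add: mult_ac)
    qed (use h in auto)
    then show ?thesis
      using h g nzl(1)[of "inv h"] nzl(1)[of "inv g \<otimes> inv h"] nzl(1)[of "inv g"]
      by (simp add: c_def m_def inv_mult_group field_simps)
  qed
  have c_mu: "c \<in> carrier G \<rightarrow> mu n"
    using w m by (auto simp: c_def intro!: mu_closed mu_divide Z2_in_mu[OF w])
  have nzc: "c g \<noteq> 0" if "g \<in> carrier G" for g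
    using c_mu that by (intro mu_nonzero[OF n]) (auto simp: Pi_iff)
  \<comment> \<open>the cocycle identity at \<open>\<one>, g, h\<close>\<close>
  have const: "c (g \<otimes> h) * m (g \<otimes> h) = c g * m g" if "g \<in> carrier G" "h \<in> carrier G" for g h
    using Z2_cocycle[OF n is_group w, of \<one> g h] that nzc[of h] m
    by (simp add: wc field_simps)
  have "\<omega> (g, h) = c h * inverse (c (g \<otimes> h)) * c g" if "g \<in> carrier G" "h \<in> carrier G" for g h
  proof -
    have "m g * \<omega> (g, h) = c h * m (g \<otimes> h)"
      using wc[OF that] m(1)[OF that(1)] by simp
    then have "m g * (\<omega> (g, h) * c (g \<otimes> h)) = c h * (c (g \<otimes> h) * m (g \<otimes> h))"
      by (simp add: mult_ac)
    then have "m g * (\<omega> (g, h) * c (g \<otimes> h)) = m g * (c h * c g)"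
      by (simp add: const[OF that] mult_ac)
    then show ?thesis
      using m(1)[OF that(1)] nzc[of "g \<otimes> h"] that by (simp add: field_simps)
  qed
  moreover have "\<omega> \<in> extensional (carrier G \<times> carrier G)"
    using w unfolding Z2_iff PiE_iff by blast
  ultimately have "\<omega> = coboundary G c"
    by (intro extensionalityI[of _ "carrier G \<times> carrier G"]) (auto simp: coboundary_def)
  then show ?thesis using c_mu by (auto simp: B2_def)
qed


section \<open>Cocyclic form and D-equivalence\<close>

lemma cocyclic_form_cong:
  assumes "\<And>x y. (x, y) \<in> \<O> \<Longrightarrow> A x y = B x y"
    and "\<And>g h. g \<in> carrier G \<Longrightarrow> h \<in> carrier G \<Longrightarrow> \<omega> (g, h) = \<omega>' (g, h)"
  shows "cocyclic_form \<omega> A \<longleftrightarrow> cocyclic_form \<omega>' B"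
proof -
  have "A x y = l x * (f (inv x \<otimes> y) * \<omega> (inv x, y)) * r y \<longleftrightarrow>
      B x y = l x * (f (inv x \<otimes> y) * \<omega>' (inv x, y)) * r y" if "(x, y) \<in> \<O>" for x y l f r
    using assms that supp_carrier[OF that] by simp
  then show ?thesis unfolding cocyclic_form_def by (simp cong: conj_cong imp_cong)
qed

lemma cocyclic_form_mult:
  assumes "cocyclic_form \<omega> A" "cocyclic_form \<omega>' B"
  shows "cocyclic_form (\<lambda>p. \<omega> p * \<omega>' p) (\<lambda>x y. A x y * B x y)"
proof -
  obtain l r f where lr: "l \<in> carrier G \<rightarrow> mu n" "r \<in> carrier G \<rightarrow> mu n"
    and eq: "\<And>x y. (x, y) \<in> \<O> \<Longrightarrow> A x y = l x * (f (inv x \<otimes> y) * \<omega> (inv x, y)) * r y"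
    using assms(1) by (rule cocyclic_formE) blast
  obtain l' r' f' where lr': "l' \<in> carrier G \<rightarrow> mu n" "r' \<in> carrier G \<rightarrow> mu n"
    and eq': "\<And>x y. (x, y) \<in> \<O> \<Longrightarrow> B x y = l' x * (f' (inv x \<otimes> y) * \<omega>' (inv x, y)) * r' y"
    using assms(2) by (rule cocyclic_formE) blast
  show ?thesis
    by (rule cocyclic_formI[of "\<lambda>x. l x * l' x" "\<lambda>y. r y * r' y" _ "\<lambda>z. f z * f' z"])
      (use lr lr' in \<open>auto simp: eq eq' Pi_iff mu_closed\<close>)
qed

lemma cocyclic_form_inverse:
  assumes "cocyclic_form \<omega> A"
  shows "cocyclic_form (\<lambda>p. inverse (\<omega> p)) (\<lambda>x y. inverse (A x y))"
proof -
  obtain l r f where lr: "l \<in> carrier G \<rightarrow> mu n" "r \<in> carrier G \<rightarrow> mu n"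
    and eq: "\<And>x y. (x, y) \<in> \<O> \<Longrightarrow> A x y = l x * (f (inv x \<otimes> y) * \<omega> (inv x, y)) * r y"
    using assms by (rule cocyclic_formE) blast
  show ?thesis
    by (rule cocyclic_formI[of "\<lambda>x. inverse (l x)" "\<lambda>y. inverse (r y)" _ "\<lambda>z. inverse (f z)"])
      (use lr in \<open>auto simp: eq Pi_iff mu_closed\<close>)
qed

lemma cocyclic_form_self: "cocyclic_form \<omega> (\<lambda>x y. \<omega> (inv x, y))"
  by (rule cocyclic_formI[of "\<lambda>_. 1" "\<lambda>_. 1" _ "\<lambda>_. 1"]) (auto simp: one_in_mu)

lemma cocyclic_form_D_equiv:
  assumes "D_equivG A B" "cocyclic_form \<omega> B"
  shows "cocyclic_form \<omega> A"
proof -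
  obtain l r f where lr: "l \<in> carrier G \<rightarrow> mu n" "r \<in> carrier G \<rightarrow> mu n"
    and eq: "\<And>x y. (x, y) \<in> \<O> \<Longrightarrow> B x y = l x * (f (inv x \<otimes> y) * \<omega> (inv x, y)) * r y"
    using assms(2) by (rule cocyclic_formE) blast
  obtain l' r' where lr': "l' \<in> carrier G \<rightarrow> mu n" "r' \<in> carrier G \<rightarrow> mu n"
    "A = (\<lambda>x y. if (x, y) \<in> carrier G \<times> carrier G then l' x * B x y * r' y else 0)"
    using assms(1) by (rule D_equivE)
  show ?thesis
    by (rule cocyclic_formI[of "\<lambda>x. l' x * l x" "\<lambda>y. r y * r' y" _ f])
      (use lr lr' in \<open>auto simp: eq Pi_iff mu_closed supp_carrier\<close>)
qed

text \<open>The diagonal scaling is undone by dividing by \<open>l x * r y\<close>; what remains of \<open>A\<close> is a cocyclic matrix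
  that still has support \<open>\<O>\<close> and entries in the roots of unity and zero.\<close>

lemma cocyclic_form_iff_D_equiv:
  assumes "A \<in> matsG" "supp A = \<O>"
  shows "cocyclic_form \<omega> A \<longleftrightarrow> (\<exists>K. developed G K \<and> hadamard K (pure_cocyclic G \<O> \<omega>) \<in> matsG
     \<and> supp (hadamard K (pure_cocyclic G \<O> \<omega>)) = \<O>
     \<and> D_equivG A (hadamard K (pure_cocyclic G \<O> \<omega>)))" (is "_ \<longleftrightarrow> ?R")
proof
  assume "cocyclic_form \<omega> A"
  then obtain l r f where lr: "l \<in> carrier G \<rightarrow> mu n" "r \<in> carrier G \<rightarrow> mu n"
    and eq: "\<And>x y. (x, y) \<in> \<O> \<Longrightarrow> A x y = l x * (f (inv x \<otimes> y) * \<omega> (inv x, y)) * r y"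
    by (rule cocyclic_formE) blast
  define K where "K x y = (if x \<in> carrier G \<and> y \<in> carrier G then f (inv x \<otimes> y) else 0)" for x y
  let ?B = "hadamard K (pure_cocyclic G \<O> \<omega>)"
  have B: "?B x y = A x y / (l x * r y)" for x y
  proof (cases "(x, y) \<in> \<O>")
    case True
    then have "l x \<noteq> 0" "r y \<noteq> 0"
      using lr supp_carrier[OF True] by (auto intro!: mu_nonzero[OF n] simp: Pi_iff)
    then show ?thesis
      using eq[OF True] supp_carrier[OF True] True
      by (simp add: hadamard_def pure_cocyclic_def K_def)
  next
    case False
    then show ?thesis
      using supp_eq_0_iff[OF assms(2), of x y] by (simp add: hadamard_def pure_cocyclic_def)
  qed
  have nz: "l x \<noteq> 0" "r x \<noteq> 0" if "x \<in> carrier G" for x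
    using lr that by (auto intro!: mu_nonzero[OF n] simp: Pi_iff)
  have "developed G K" by (auto simp: developed_def K_def)
  moreover have "?B \<in> matsG"
  proof -
    have "?B x y \<in> mu_plus n" if "x \<in> carrier G" "y \<in> carrier G" for x y
      using assms(1) lr that by (auto simp: B mats_def mu_plus_def Pi_iff mu_closed intro!: mu_divide)
    moreover have "?B x y = 0" if "(x, y) \<notin> carrier G \<times> carrier G" for x y
      using assms(1) that by (auto simp: B mats_def)
    ultimately show ?thesis unfolding mats_def by blast
  qed
  moreover have "supp ?B = \<O>"
    using assms(2) nz supp_carrier by (auto simp: supp_def B)
  moreover have "D_equivG A ?B"
    by (rule D_equivI[OF assms(1) lr]) (simp add: B nz)
  ultimately show ?R by blast
next
  assume ?R
  then obtain K where K: "developed G K"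
    and D: "D_equivG A (hadamard K (pure_cocyclic G \<O> \<omega>))"
    by blast
  obtain f where f: "\<And>x y. x \<in> carrier G \<Longrightarrow> y \<in> carrier G \<Longrightarrow> K x y = f (inv x \<otimes> y)"
    using K by (auto simp: developed_def)
  have "cocyclic_form \<omega> (hadamard K (pure_cocyclic G \<O> \<omega>))"
    by (rule cocyclic_formI[of "\<lambda>_. 1" "\<lambda>_. 1" _ f])
      (auto simp: one_in_mu hadamard_def pure_cocyclic_def f supp_carrier)
  then show "cocyclic_form \<omega> A" using D cocyclic_form_D_equiv by blast
qed

theorem h2_eq_closure: "h2G = D_closure n (carrier G) (carrier G)
   {A \<in> cocyclic_mats n G \<O>. A \<in> matsG \<and> supp A = \<O>}"
proof (intro equalityI subsetI)
  fix A assume A: "A \<in> h2G"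
  then obtain \<omega> where "\<omega> \<in> Z2 n G" "cocyclic_form \<omega> A" by (rule h2_cocyclic_formE)
  then show "A \<in> D_closure n (carrier G) (carrier G)
   {A \<in> cocyclic_mats n G \<O>. A \<in> matsG \<and> supp A = \<O>}"
    unfolding cocyclic_form_iff_D_equiv[OF h2_D[OF A]] D_closure_def cocyclic_mats_def by blast
next
  fix A assume "A \<in> D_closure n (carrier G) (carrier G)
   {A \<in> cocyclic_mats n G \<O>. A \<in> matsG \<and> supp A = \<O>}"
  then obtain K \<omega> where B: "developed G K" "\<omega> \<in> Z2 n G"
     "hadamard K (pure_cocyclic G \<O> \<omega>) \<in> matsG"
     "supp (hadamard K (pure_cocyclic G \<O> \<omega>)) = \<O>"
     and D: "D_equivG A (hadamard K (pure_cocyclic G \<O> \<omega>))"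
    unfolding D_closure_def cocyclic_mats_def by blast
  obtain l r where lr: "l \<in> carrier G \<rightarrow> mu n" "r \<in> carrier G \<rightarrow> mu n"
    and Aeq: "A = (\<lambda>x y. if (x, y) \<in> carrier G \<times> carrier G then
      l x * hadamard K (pure_cocyclic G \<O> \<omega>) x y * r y else 0)"
    using D by (rule D_equivE)
  have nz: "l x \<noteq> 0" "r x \<noteq> 0" if "x \<in> carrier G" for x
    using lr that by (auto intro!: mu_nonzero[OF n] simp: Pi_iff)
  have A: "A \<in> matsG" "supp A = \<O>"
  proof -
    have "A x y \<in> mu_plus n" if "x \<in> carrier G" "y \<in> carrier G" for x y
    proof -
      have "l x \<in> mu_plus n" "r y \<in> mu_plus n"
        using lr that by (auto simp: mu_plus_def)
      moreover have "hadamard K (pure_cocyclic G \<O> \<omega>) x y \<in> mu_plus n"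
        using B(3) that by (simp add: mats_def)
      ultimately show ?thesis using that by (simp add: Aeq mu_plus_closed)
    qed
    then show "A \<in> matsG"
      by (auto simp: mats_def Aeq)
    show "supp A = \<O>"
      using B(4) sub nz by (force simp: supp_def Aeq)
  qed
  have "cocyclic_form \<omega> A"
    unfolding cocyclic_form_iff_D_equiv[OF A] using B D by blast
  then show "A \<in> h2G" by (rule cocyclic_form_in_h2[OF A B(2)])
qed

section \<open>Monomial symmetries\<close>

text \<open>A matrix fixed by \<open>G\<close> satisfies \<open>B x y = B \<one> (x\<^sup>-\<^sup>1 y)\<close>, as one sees by acting with \<open>x\<close>. Conversely, a
  developed matrix restricted to the stable set \<open>\<O>\<close> is fixed.\<close>

lemma h0_iff_cocyclic_form: "A \<in> h0G \<longleftrightarrow> A \<in> h2G \<and> cocyclic_form (\<lambda>_. 1) A"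
proof (intro iffI conjI)
  assume "A \<in> h0G"
  then show "A \<in> h2G" by (simp add: h0_def)
  from \<open>A \<in> h0G\<close> obtain B where B: "B \<in> matsG"
    "\<And>g. g \<in> carrier G \<Longrightarrow> actG g B = B"
    and D: "D_equivG A B"
    by (auto simp: h0_def)
  have dev: "B x y = B \<one> (inv x \<otimes> y)" if "x \<in> carrier G" "y \<in> carrier G" for x y
    using fun_cong[OF fun_cong[OF B(2)[OF that(1)], of x], of y] that
    by (simp add: act_mat_def left_mult_def)
  have "cocyclic_form (\<lambda>_. 1) B"
  proof (rule cocyclic_formI[of "\<lambda>_. 1" "\<lambda>_. 1" _ "B \<one>"])
    show "B x y = 1 * (B \<one> (inv x \<otimes> y) * 1) * 1" if "(x, y) \<in> \<O>" for x y
      using dev[OF supp_carrier[OF that]] by simp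
  qed (simp_all add: one_in_mu)
  then show "cocyclic_form (\<lambda>_. 1) A" using D cocyclic_form_D_equiv by blast
next
  assume A: "A \<in> h2G \<and> cocyclic_form (\<lambda>_. 1) A"
  then obtain K where K: "developed G K" "hadamard K (pure_cocyclic G \<O> (\<lambda>_. 1)) \<in> matsG"
     "D_equivG A (hadamard K (pure_cocyclic G \<O> (\<lambda>_. 1)))"
    using cocyclic_form_iff_D_equiv[OF h2_D, of A] by blast
  obtain f where f: "\<And>x y. x \<in> carrier G \<Longrightarrow> y \<in> carrier G \<Longrightarrow> K x y = f (inv x \<otimes> y)"
    using K by (auto simp: developed_def)
  have "actG g
      (hadamard K (pure_cocyclic G \<O> (\<lambda>_. 1))) = hadamard K (pure_cocyclic G \<O> (\<lambda>_. 1))"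
    if "g \<in> carrier G" for g
    using that translate_supp_iff[of "inv g"] sub
    by (auto simp: fun_eq_iff act_mat_def left_mult_def hadamard_def pure_cocyclic_def f inv_translate)
  then show "A \<in> h0G" using A K by (auto simp: h0_def)
qed

text \<open>The conjugate of the permutation matrix of \<open>g\<close> by the diagonal matrix with entries \<open>d\<close>. Being a
  conjugate of a representation, it is multiplicative in \<open>g\<close>.\<close>

definition scaled_translation :: "('a \<Rightarrow> complex) \<Rightarrow> 'a \<Rightarrow> ('a, 'a) cmat" where
  "scaled_translation d g = (\<lambda>x x'.
     if x \<in> carrier G \<and> x' \<in> carrier G \<and> x = g \<otimes> x' then d x / d x' else 0)"

lemma scaled_translation_eq_0:
  assumes "x' \<in> carrier G" "x' \<noteq> inv g \<otimes> x" "g \<in> carrier G"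
  shows "scaled_translation d g x x' = 0"
  using assms by (auto simp: scaled_translation_def cancel_left)

lemma scaled_translation_entry:
  assumes "x \<in> carrier G" "g \<in> carrier G"
  shows "scaled_translation d g x (inv g \<otimes> x) = d x / d (inv g \<otimes> x)"
  using assms by (auto simp: scaled_translation_def cancel_left)

lemma scaled_translation_monomial:
  assumes d: "d \<in> carrier G \<rightarrow> mu n" and g: "g \<in> carrier G"
  shows "scaled_translation d g \<in> carrier monomialG"
    and "abs_mat (scaled_translation d g) = perm_mat (carrier G) (left_mult G g)"
    and "h \<in> carrier G \<Longrightarrow> scaled_translation d (g \<otimes> h) =
           mmul (carrier G) (scaled_translation d g) (scaled_translation d h)"
proof -
  have nz: "d x \<noteq> 0" if "x \<in> carrier G" for x
    using d that by (auto intro!: mu_nonzero[OF n] simp: Pi_iff)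
  have Mnz: "scaled_translation d g x x' \<noteq> 0 \<longleftrightarrow> x \<in> carrier G \<and> x' \<in> carrier G \<and> x = g \<otimes> x'" for x x'
    by (auto simp: scaled_translation_def nz)
  have "scaled_translation d g \<in> matsG"
    using d by (auto simp: mats_def scaled_translation_def mu_plus_def Pi_iff intro!: mu_divide)
  moreover have "\<exists>!x'. x' \<in> carrier G \<and> scaled_translation d g x x' \<noteq> 0" if "x \<in> carrier G" for x
    unfolding Mnz by (rule ex1I[of _ "inv g \<otimes> x"]) (use g that in \<open>auto simp: cancel_left\<close>)
  moreover have "\<exists>!x. x \<in> carrier G \<and> scaled_translation d g x x' \<noteq> 0" if "x' \<in> carrier G" for x'
    unfolding Mnz by (rule ex1I[of _ "g \<otimes> x'"]) (use g that in \<open>auto simp: cancel_left\<close>)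
  ultimately show "scaled_translation d g \<in> carrier monomialG"
    by (simp add: monomial_group_def)
  have "cmod (d x) = 1" if "x \<in> carrier G" for x
    using d that by (auto intro!: norm_mu[OF n] simp: Pi_iff)
  then show "abs_mat (scaled_translation d g) = perm_mat (carrier G) (left_mult G g)"
    using g by (auto simp: abs_mat_def perm_mat_def scaled_translation_def left_mult_def fun_eq_iff norm_divide)
  assume h: "h \<in> carrier G"
  show "scaled_translation d (g \<otimes> h) = mmul (carrier G) (scaled_translation d g) (scaled_translation d h)"
  proof (intro ext)
    fix x z
    show "scaled_translation d (g \<otimes> h) x z = mmul (carrier G) (scaled_translation d g) (scaled_translation d h) x z"
    proof (cases "x \<in> carrier G \<and> z \<in> carrier G")
      case True
      then have "mmul (carrier G) (scaled_translation d g) (scaled_translation d h) x z =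
          scaled_translation d g x (inv g \<otimes> x) * scaled_translation d h (inv g \<otimes> x) z"
        using g by (intro mmul_single_entry fin scaled_translation_eq_0) auto
      also have "\<dots> = scaled_translation d (g \<otimes> h) x z"
      proof -
        have "x = g \<otimes> h \<otimes> z \<longleftrightarrow> inv g \<otimes> x = h \<otimes> z"
          using True g h inv_solve_left[of "h \<otimes> z" g x] by (auto simp: m_assoc)
        then show ?thesis
          using True g h by (auto simp: scaled_translation_def cancel_left nz)
      qed
      finally show ?thesis by simp
    next
      case False
      then show ?thesis by (auto simp: scaled_translation_def mmul_def)
    qed
  qed
qed

text \<open>If \<open>A\<close> arises from an invariant matrix by diagonal scalings, then the conjugates of the permutation
  matrices by these scalings fix \<open>A\<close>.\<close>

lemma h0_subset_h1: "h0G \<subseteq> h1G"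
proof
  fix A assume A0: "A \<in> h0G"
  then have A: "A \<in> h2G" "cocyclic_form (\<lambda>_. 1) A" by (simp_all add: h0_iff_cocyclic_form)
  from A(2) obtain l r f where lr: "l \<in> carrier G \<rightarrow> mu n" "r \<in> carrier G \<rightarrow> mu n"
    and eq: "\<And>x y. (x, y) \<in> \<O> \<Longrightarrow> A x y = l x * (f (inv x \<otimes> y) * 1) * r y"
    by (rule cocyclic_formE) blast
  \<comment> \<open>The right-hand matrix enters through its adjoint, hence the conjugate.\<close>
  define r' where "r' y = cnj (r y)" for y
  have r': "r' \<in> carrier G \<rightarrow> mu n" using lr by (auto simp: r'_def mu_closed Pi_iff)
  have nz: "l x \<noteq> 0" "r x \<noteq> 0" if "x \<in> carrier G" for x
    using lr that by (auto intro!: mu_nonzero[OF n] simp: Pi_iff)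
  have "(\<lambda>g. (scaled_translation l g, scaled_translation r' g)) \<in> hom G (monomialG \<times>\<times> monomialG)"
    using lr(1) r' by (auto simp: hom_def scaled_translation_monomial) (auto simp: monomial_group_def)
  moreover have "mmul (carrier G) (scaled_translation l g)
      (mmul (carrier G) A (adj (scaled_translation r' g))) = A"
    if g: "g \<in> carrier G" for g
  proof (intro ext)
    fix x y
    show "mmul (carrier G) (scaled_translation l g)
      (mmul (carrier G) A (adj (scaled_translation r' g))) x y = A x y"
    proof (cases "x \<in> carrier G \<and> y \<in> carrier G")
      case True
      then have "mmul (carrier G) (scaled_translation l g)
      (mmul (carrier G) A (adj (scaled_translation r' g))) x y =
          scaled_translation l g x (inv g \<otimes> x) * A (inv g \<otimes> x) (inv g \<otimes> y) *
          cnj (scaled_translation r' g y (inv g \<otimes> y))"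
        using g by (intro conjugate_single_entry fin scaled_translation_eq_0) auto
      also have "\<dots> = A x y"
      proof (cases "(x, y) \<in> \<O>")
        case xy: True
        then show ?thesis
          using True g eq[OF translate_supp[OF xy, of "inv g"]] eq[OF xy] nz
          by (simp add: scaled_translation_entry r'_def inv_translate)
      next
        case False
        then show ?thesis
          using True g supp_eq_0_iff[OF h2_D(2)[OF A(1)], of x y] translate_supp_iff[of "inv g" x y]
            supp_eq_0_iff[OF h2_D(2)[OF A(1)], of "inv g \<otimes> x" "inv g \<otimes> y"] by simp
      qed
      finally show ?thesis .
    next
      case False
      then have "A x y = 0" using h2_D(1)[OF A(1)] by (auto simp: mats_def)
      then show ?thesis using False by (auto simp: mmul_def adj_def scaled_translation_def)
    qed
  qed
  ultimately show "A \<in> h1G"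
    using A(1) scaled_translation_monomial(2)[OF lr(1)]
      scaled_translation_monomial(2)[OF r']
    unfolding h1_def by blast
qed

text \<open>The symmetry indexed by \<open>x\<close> itself moves row \<open>x\<close> to row \<open>\<one>\<close>. Its column factor is the
  conjugate of \<open>Q x y z\<close>, where \<open>z = x\<^sup>-\<^sup>1 y\<close>. This entry equals \<open>Q y y \<one> / Q z z \<one>\<close> because
  \<open>Q\<close> is a homomorphism, and so splits into a function of \<open>y\<close> and one of \<open>z\<close>.\<close>

lemma h1_subset_h0: "h1G \<subseteq> h0G"
proof
  fix A assume "A \<in> h1G"
  then obtain P Q where A: "A \<in> h2G"
    and hom: "(\<lambda>g. (P g, Q g)) \<in> hom G (monomialG \<times>\<times> monomialG)"
    and PQ: "\<And>g. g \<in> carrier G \<Longrightarrow> abs_mat (P g) = perm_mat (carrier G) (left_mult G g)"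
      "\<And>g. g \<in> carrier G \<Longrightarrow> abs_mat (Q g) = perm_mat (carrier G) (left_mult G g)"
    and fixed: "\<And>g. g \<in> carrier G \<Longrightarrow> mmul (carrier G) (P g) (mmul (carrier G) A (adj (Q g))) = A"
    unfolding h1_def by blast
  have mono: "P g \<in> matsG" "Q g \<in> matsG"
    if "g \<in> carrier G" for g
    using hom that by (auto simp: hom_def monomial_group_def)
  have Qmult: "Q (g \<otimes> h) = mmul (carrier G) (Q g) (Q h)"
    if "g \<in> carrier G" "h \<in> carrier G" for g h
    using hom that by (auto simp: hom_def monomial_group_def)
  have zero: "M x x' = 0" if "abs_mat M = perm_mat (carrier G) (left_mult G g)"
    "x' \<in> carrier G" "x' \<noteq> inv g \<otimes> x" "g \<in> carrier G" for M g x x'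
    using fun_cong[OF fun_cong[OF that(1), of x], of x'] that(2-4)
    by (auto simp: abs_mat_def perm_mat_def left_mult_def cancel_left split: if_splits)
  have unit: "M x (inv g \<otimes> x) \<in> mu n" if "abs_mat M = perm_mat (carrier G) (left_mult G g)"
    "M \<in> matsG" "x \<in> carrier G" "g \<in> carrier G" for M g x
  proof -
    have "cmod (M x (inv g \<otimes> x)) = 1"
      using fun_cong[OF fun_cong[OF that(1), of x], of "inv g \<otimes> x"] that(3,4)
      by (auto simp: abs_mat_def perm_mat_def left_mult_def cancel_left)
    moreover have "M x (inv g \<otimes> x) \<in> mu_plus n"
      using that by (simp add: mats_def)
    ultimately show ?thesis by (auto simp: mu_plus_def)
  qed
  define l where "l x = P x x \<one>" for x
  define q where "q y = Q y y \<one>" for y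
  have lr: "l \<in> carrier G \<rightarrow> mu n" "(\<lambda>y. cnj (q y)) \<in> carrier G \<rightarrow> mu n"
  proof -
    have "l x \<in> mu n" "q x \<in> mu n" if "x \<in> carrier G" for x
      using unit[OF PQ(1)[OF that] mono(1)[OF that] that that]
        unit[OF PQ(2)[OF that] mono(2)[OF that] that that] that by (simp_all add: l_def q_def)
    then show "l \<in> carrier G \<rightarrow> mu n" "(\<lambda>y. cnj (q y)) \<in> carrier G \<rightarrow> mu n"
      by (simp_all add: Pi_iff mu_closed(3)[OF _ one_in_mu])
  qed
  have nzq: "q y \<noteq> 0" if "y \<in> carrier G" for y
    using lr(2) mu_nonzero[OF n, of "cnj (q y)"] that by (auto simp: Pi_iff)
  have "cocyclic_form (\<lambda>_. 1) A"
  proof (rule cocyclic_formI[OF lr])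
    fix x y assume xy: "(x, y) \<in> \<O>"
    note c = supp_carrier[OF xy]
    define z where "z = inv x \<otimes> y"
    have z: "z \<in> carrier G" "x \<otimes> z = y" using c by (simp_all add: z_def cancel_left)
    have "Q (x \<otimes> z) y \<one> = Q x y (inv x \<otimes> y) * Q z (inv x \<otimes> y) \<one>"
      unfolding Qmult[OF c(1) z(1)]
      using c by (intro mmul_single_entry fin zero[OF PQ(2)]) auto
    then have qy: "q y = Q x y z * q z"
      by (simp add: q_def z flip: z_def)
    have "A x y = P x x (inv x \<otimes> x) * A (inv x \<otimes> x) (inv x \<otimes> y) * cnj (Q x y (inv x \<otimes> y))"
      using c by (subst fixed[OF c(1), symmetric], intro conjugate_single_entry fin zero[OF PQ(1)] zero[OF PQ(2)]) auto
    also have "\<dots> = l x * A \<one> z * cnj (Q x y z)"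
      using c by (simp add: l_def z_def)
    also have "\<dots> = l x * ((A \<one> z / cnj (q z)) * 1) * cnj (q y)"
      using nzq[OF z(1)] by (simp add: qy)
    finally show "A x y = l x * ((\<lambda>z. A \<one> z / cnj (q z)) (inv x \<otimes> y) * 1) * cnj (q y)"
      by (simp add: z_def)
  qed
  with A show "A \<in> h0G" by (simp add: h0_iff_cocyclic_form)
qed

section \<open>The quotient and second cohomology\<close>

lemma pure_cocyclic_in_h2:
  assumes "\<omega> \<in> Z2 n G"
  shows "pure_cocyclic G \<O> \<omega> \<in> h2G"
proof (rule cocyclic_form_in_h2[OF _ _ assms])
  have nz: "\<omega> (inv x, y) \<noteq> 0" if "(x, y) \<in> \<O>" for x y
    using assms supp_carrier[OF that] by (auto intro!: mu_nonzero[OF n] Z2_in_mu)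
  show "pure_cocyclic G \<O> \<omega> \<in> matsG"
    using assms sub by (auto simp: mats_def pure_cocyclic_def mu_plus_def intro!: Z2_in_mu)
  show "supp (pure_cocyclic G \<O> \<omega>) = \<O>"
    by (auto simp: supp_def pure_cocyclic_def nz)
  show "cocyclic_form \<omega> (pure_cocyclic G \<O> \<omega>)"
    using cocyclic_form_self[of \<omega>] cocyclic_form_cong[of "pure_cocyclic G \<O> \<omega>" "\<lambda>x y. \<omega> (inv x, y)" \<omega> \<omega>]
    by (simp add: pure_cocyclic_def)
qed

text \<open>If the pure cocyclic matrix of \<open>\<omega>\<close> has cocyclic form \<open>1\<close>, dividing it by itself exhibits the
  all-one matrix in cocyclic form \<open>\<omega>\<close>. Conversely, the coboundary of \<open>c\<close> at \<open>(x\<^sup>-\<^sup>1, y)\<close> is literally a row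
  factor \<open>c (x\<^sup>-\<^sup>1)\<close>, a developed factor and a column factor \<open>c y\<close>.\<close>

lemma pure_cocyclic_in_h0_iff:
  assumes w: "\<omega> \<in> Z2 n G"
  shows "pure_cocyclic G \<O> \<omega> \<in> h0G \<longleftrightarrow> \<omega> \<in> B2 n G"
proof
  have nz: "\<omega> (inv x, y) \<noteq> 0" if "(x, y) \<in> \<O>" for x y
    using assms supp_carrier[OF that] by (auto intro!: mu_nonzero[OF n] Z2_in_mu)
  assume "pure_cocyclic G \<O> \<omega> \<in> h0G"
  then have "cocyclic_form (\<lambda>_. 1) (pure_cocyclic G \<O> \<omega>)" by (simp add: h0_iff_cocyclic_form)
  from cocyclic_form_mult[OF cocyclic_form_inverse[OF this] cocyclic_form_self[of \<omega>]]
  have "cocyclic_form \<omega> (\<lambda>x y. 1)"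
    by (subst cocyclic_form_cong) (auto simp: pure_cocyclic_def nz)
  with w show "\<omega> \<in> B2 n G" by (rule coboundary_if_cocyclic_form_one)
next
  assume "\<omega> \<in> B2 n G"
  then obtain c where c: "c \<in> carrier G \<rightarrow> mu n" and w': "\<omega> = coboundary G c"
    by (auto simp: B2_def)
  have "cocyclic_form (\<lambda>_. 1) (pure_cocyclic G \<O> \<omega>)"
    by (rule cocyclic_formI[of "\<lambda>x. c (inv x)" c _ "\<lambda>z. inverse (c z)"])
      (use c in \<open>auto simp: pure_cocyclic_def w' coboundary_def supp_carrier Pi_iff\<close>)
  then show "pure_cocyclic G \<O> \<omega> \<in> h0G"
    using pure_cocyclic_in_h2[OF w] by (simp add: h0_iff_cocyclic_form)
qed

lemma h2_group_simps [simp]: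
  "carrier h2G_group = h2G" "A \<otimes>\<^bsub>h2G_group\<^esub> B = hadamard A B"
  by (simp_all add: h2_group_def)

lemma h2_eq_h0_times_pure_cocyclic:
  assumes A: "A \<in> h2G"
  obtains B \<omega> where "B \<in> h0G" "\<omega> \<in> Z2 n G" "A = hadamard B (pure_cocyclic G \<O> \<omega>)"
proof -
  obtain \<omega> where w: "\<omega> \<in> Z2 n G" "cocyclic_form \<omega> A" using A by (rule h2_cocyclic_formE)
  let ?C = "pure_cocyclic G \<O> \<omega>"
  let ?B = "hadamard A (hinv ?C)"
  have nz: "\<omega> (inv x, y) \<noteq> 0" if "(x, y) \<in> \<O>" for x y
    using supp_carrier[OF that] by (intro mu_nonzero[OF n] Z2_in_mu[OF w(1)]) auto
  have 1: "cocyclic_form (\<lambda>p. \<omega> p * inverse (\<omega> p)) (\<lambda>x y. A x y * inverse (\<omega> (inv x, y)))"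
    using cocyclic_form_mult[OF w(2) cocyclic_form_inverse[OF cocyclic_form_self[of \<omega>]]] .
  have 2: "cocyclic_form (\<lambda>p. \<omega> p * inverse (\<omega> p)) (\<lambda>x y. A x y * inverse (\<omega> (inv x, y))) \<longleftrightarrow>
      cocyclic_form (\<lambda>_. 1) ?B"
  proof (rule cocyclic_form_cong)
    show "A x y * inverse (\<omega> (inv x, y)) = ?B x y" if "(x, y) \<in> \<O>" for x y
      using that by (simp add: hadamard_def hinv_def pure_cocyclic_def)
    show "\<omega> (g, h) * inverse (\<omega> (g, h)) = 1" if "g \<in> carrier G" "h \<in> carrier G" for g h
      using mu_nonzero[OF n Z2_in_mu[OF w(1) that]] by simp
  qed
  have 3: "cocyclic_form (\<lambda>_. 1) ?B"
    by (rule iffD1[OF 2 1])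
  have 4: "?B \<in> h2G"
    using A pure_cocyclic_in_h2[OF w(1)] by (intro h2_hadamard h2_hinv fin n)
  have 5: "?B \<in> h0G" unfolding h0_iff_cocyclic_form using 3 4 by (rule conjI[rotated])
  have 6: "A = hadamard ?B ?C"
    using supp_eq_0_iff[OF h2_D(2)[OF A]]
    by (auto simp: fun_eq_iff hadamard_def hinv_def pure_cocyclic_def nz)
  show ?thesis by (rule that[OF 5 w(1) 6])
qed

text \<open>Going from cocycles to classes of pure cocyclic matrices requires no choice of a cocycle, and is a
  homomorphism by inspection; the stated isomorphism is the inverse of the induced map.\<close>

theorem h2_mod_h0_iso: "h2G_group Mod h0G \<cong> H2 n G"
proof -
  note act = group_action_left_mult[OF is_group]
  interpret H: comm_group h2G_group
    by (rule comm_group_h2[OF act act fin fin n sub stable])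
  interpret Z: comm_group "Z2_group n G"
    by (rule comm_group_Z2[OF is_group n])
  have H0: "subgroup h0G h2G_group"
    by (rule subgroup_h0[OF act act fin fin n sub stable])
  interpret H0: normal h0G h2G_group
    by (rule H.subgroup_imp_normal[OF H0])
  have H0_sub: "h0G \<subseteq> h2G"
    by (auto simp: h0_def)
  have Z2: "carrier (Z2_group n G) = Z2 n G"
    by (simp add: Z2_group_def)
  define \<Phi> where "\<Phi> = (\<lambda>A. h0G #>\<^bsub>h2G_group\<^esub> A) \<circ> pure_cocyclic G \<O>"
  have "pure_cocyclic G \<O> \<in> hom (Z2_group n G) h2G_group"
  proof (rule homI)
    fix \<omega> \<omega>'
    show "pure_cocyclic G \<O> (\<omega> \<otimes>\<^bsub>Z2_group n G\<^esub> \<omega>') =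
        pure_cocyclic G \<O> \<omega> \<otimes>\<^bsub>h2G_group\<^esub> pure_cocyclic G \<O> \<omega>'"
      by (auto simp: Z2_group_def pure_cocyclic_def hadamard_def fun_eq_iff supp_carrier)
  qed (simp add: Z2 pure_cocyclic_in_h2)
  then have hom: "\<Phi> \<in> hom (Z2_group n G) (h2G_group Mod h0G)"
    unfolding \<Phi>_def by (rule Group.hom_compose[OF _ H0.r_coset_hom_Mod])
  interpret \<Phi>: group_hom "Z2_group n G" "h2G_group Mod h0G" \<Phi>
    using hom by (simp add: group_hom_def group_hom_axioms_def Z.is_group H0.factorgroup_is_group)
  have surj: "\<Phi> ` carrier (Z2_group n G) = carrier (h2G_group Mod h0G)"
  proof
    show "\<Phi> ` carrier (Z2_group n G) \<subseteq> carrier (h2G_group Mod h0G)"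
      using hom by (rule hom_carrier)
    show "carrier (h2G_group Mod h0G) \<subseteq> \<Phi> ` carrier (Z2_group n G)"
    proof
      fix C assume "C \<in> carrier (h2G_group Mod h0G)"
      then obtain A where A: "A \<in> h2G" "C = h0G #>\<^bsub>h2G_group\<^esub> A"
        unfolding carrier_FactGroup by auto
      obtain B \<omega> where w: "B \<in> h0G" "\<omega> \<in> Z2 n G" "A = hadamard B (pure_cocyclic G \<O> \<omega>)"
        using A(1) by (rule h2_eq_h0_times_pure_cocyclic)
      have "A \<in> \<Phi> \<omega>"
        using w(1) unfolding \<Phi>_def w(3) by (auto simp: r_coset_def)
      then have "C = \<Phi> \<omega>"
        using H.repr_independence[OF _ _ H0, of A "pure_cocyclic G \<O> \<omega>"]
          pure_cocyclic_in_h2[OF w(2)] by (simp add: \<Phi>_def A(2))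
      then show "C \<in> \<Phi> ` carrier (Z2_group n G)"
        using w(2) by (simp add: Z2)
    qed
  qed
  have "\<Phi> \<omega> = h0G \<longleftrightarrow> \<omega> \<in> B2 n G" if w: "\<omega> \<in> Z2 n G" for \<omega>
  proof -
    note C = pure_cocyclic_in_h2[OF w]
    have "\<Phi> \<omega> = h0G \<longleftrightarrow> pure_cocyclic G \<O> \<omega> \<in> h0G"
      using H.coset_join1[OF _ _ H0, of "pure_cocyclic G \<O> \<omega>"]
        H.coset_join2[OF _ H0, of "pure_cocyclic G \<O> \<omega>"] C H0_sub
      unfolding \<Phi>_def comp_def h2_group_simps by blast
    then show ?thesis by (simp only: pure_cocyclic_in_h0_iff[OF w])
  qed
  moreover have B2: "subgroup (B2 n G) (Z2_group n G)"
    by (rule subgroup_B2[OF is_group n])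
  ultimately have ker: "kernel (Z2_group n G) (h2G_group Mod h0G) \<Phi> = B2 n G"
    using subgroup.subset[OF B2] by (auto simp only: kernel_def one_FactGroup Z2)
  have "Z2_group n G Mod B2 n G \<cong> h2G_group Mod h0G"
    using \<Phi>.FactGroup_iso[OF surj] by (simp only: ker)
  moreover have "group (Z2_group n G Mod B2 n G)"
    by (rule normal.factorgroup_is_group[OF Z.subgroup_imp_normal[OF B2]])
  ultimately show ?thesis
    unfolding H2_def by (rule group.iso_sym[rotated])
qed

end

theorem theorem7p8:
  fixes G :: "('g, 'm) monoid_scheme" and n :: nat and \<O> :: "('g \<times> 'g) set"
  assumes "group G" and "finite (carrier G)" and "1 \<le> n"
    and "\<O> \<subseteq> carrier G \<times> carrier G"
    and "stable_set G (left_mult G) (left_mult G) \<O>"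
    and "irreducible_set (carrier G) (carrier G) \<O>"
  shows "h0 n G (carrier G) (left_mult G) (carrier G) (left_mult G) \<O> =
           h1 n G (carrier G) (left_mult G) (carrier G) (left_mult G) \<O> \<and>
         h2 n G (carrier G) (left_mult G) (carrier G) (left_mult G) \<O> =
           D_closure n (carrier G) (carrier G)
             {A \<in> cocyclic_mats n G \<O>. A \<in> mats n (carrier G) (carrier G) \<and> supp A = \<O>} \<and>
         h2_group n G (carrier G) (left_mult G) (carrier G) (left_mult G) \<O>
           Mod h0 n G (carrier G) (left_mult G) (carrier G) (left_mult G) \<O> \<cong> H2 n G"
proof -
  interpret regular_support G n \<O>
    using assms by (simp add: regular_support_def regular_support_axioms_def)
  show ?thesis
    using h0_subset_h1 h1_subset_h0 h2_eq_closure h2_mod_h0_iso by blast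
qed

end
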